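(* Let $p$ be a constant and let $q:\mathbb{R}^2\to\mathbb{R}$ be a measurable function with $1<p<q_-\le q_+<\infty$. Let $\alpha,\beta:\mathbb{R}\to\mathbb{R}$ be measurable functions with $$\frac1p-\frac1{q_+}<\alpha_-\le\alpha_+<\frac1p,\qquad \frac1p-\frac1{q_+}<\beta_-\le\beta_+<\frac1p,$$ and let $v$ be a weight on $\mathbb{R}^2$. Then $M^S_{\alpha(\cdot),\beta(\cdot)}$ is bounded from $L^p(\mathbb{R}^2)$ to $L^{q(\cdot)}_v(\mathbb{R}^2)$ if and only if $$\sup_{I,J\subset\mathbb{R}}\big\||I|^{\alpha(\cdot)}|J|^{\beta(\cdot)}v(\cdot)\big\|_{L^{q(\cdot)}(I\times J)}\,|I\times J|^{-\frac1p}<\infty,$$ where the supremum is over all bounded intervals $I,J$ in $\mathbb{R}$.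
   Context: For a function $g$ on its domain, $g_-$ and $g_+$ denote its infimum and supremum. A weight is an a.e. positive measurable function. The norm of $L^{q(\cdot)}(E)$ is $\|f\|_{L^{q(\cdot)}(E)}=\inf\{\lambda>0:\int_E|f(x)/\lambda|^{q(x)}dx\le1\}$, and $\|f\|_{L^{q(\cdot)}_v}=\|fv\|_{L^{q(\cdot)}}$. Intervals have positive length, and $|I|^{\alpha(\cdot)}|J|^{\beta(\cdot)}v(\cdot)$ denotes the function $(s,t)\mapsto |I|^{\alpha(s)}|J|^{\beta(t)}v(s,t)$. The strong fractional maximal operator of variable order is $$(M^S_{\alpha(\cdot),\beta(\cdot)}f)(x,y)=\sup_{I\ni x,\ J\ni y}|I|^{\alpha(x)-1}|J|^{\beta(y)-1}\iint_{I\times J}|f(t,\tau)|\,dt\,d\tau,$$ the supremum being over bounded intervals $I\ni x$, $J\ni y$. Bounded means that there is $c>0$ with $\|M^S_{\alpha(\cdot),\beta(\cdot)}f\|_{L^{q(\cdot)}_v}\le c\|f\|_{L^p}$ for all $f\in L^p(\mathbb{R}^2)$. *)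

theory Defs
  imports "HOL-Analysis.Analysis"
begin

definition fun_inf :: "('a \<Rightarrow> real) \<Rightarrow> ereal" where
  "fun_inf g = (INF x. ereal (g x))"

definition fun_sup :: "('a \<Rightarrow> real) \<Rightarrow> ereal" where
  "fun_sup g = (SUP x. ereal (g x))"

text \<open>Power on the extended half-line, with the usual value at infinity when the exponent is
  positive. Below it is only used with positive exponents.\<close>

definition ennpowr :: "ennreal \<Rightarrow> real \<Rightarrow> ennreal" where
  "ennpowr x r =
     (if x = \<infinity> then (if r > 0 then \<infinity> else if r = 0 then 1 else 0)
      else ennreal (enn2real x powr r))"

definition bounded_intervals :: "real set set" where
  "bounded_intervals = {I. is_interval I \<and> bounded I \<and> 0 < measure lebesgue I}"

definition weight :: "('a::euclidean_space \<Rightarrow> real) \<Rightarrow> bool" where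
  "weight v \<longleftrightarrow> v \<in> borel_measurable lebesgue \<and> (AE z in lebesgue. 0 < v z)"

text \<open>The Luxemburg norm depends on the absolute value of the function only and is needed for
  functions that may take the value infinity (maximal functions), so the last argument is the
  absolute value, as a function into \<^typ>\<open>ennreal\<close>. The infimum is infinite when no
  \<open>l\<close> is admissible.\<close>

definition Lvar_norm ::
  "('a::euclidean_space \<Rightarrow> real) \<Rightarrow> 'a set \<Rightarrow> ('a \<Rightarrow> ennreal) \<Rightarrow> ennreal" where
  "Lvar_norm q E F =
     Inf {ennreal l |l::real.
       0 < l \<and> (\<integral>\<^sup>+ z\<in>E. ennpowr (F z / ennreal l) (q z) \<partial>lebesgue) \<le> 1}"

definition Lvar_weighted_norm ::
  "('a::euclidean_space \<Rightarrow> real) \<Rightarrow> ('a \<Rightarrow> real) \<Rightarrow> ('a \<Rightarrow> ennreal) \<Rightarrow> ennreal" where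
  "Lvar_weighted_norm q v F = Lvar_norm q UNIV (\<lambda>z. F z * ennreal \<bar>v z\<bar>)"

definition Lp_norm :: "real \<Rightarrow> ('a::euclidean_space \<Rightarrow> real) \<Rightarrow> ennreal" where
  "Lp_norm p f = ennpowr (\<integral>\<^sup>+ z. ennreal (\<bar>f z\<bar> powr p) \<partial>lebesgue) (1 / p)"

definition Lp_space :: "real \<Rightarrow> ('a::euclidean_space \<Rightarrow> real) set" where
  "Lp_space p = {f \<in> borel_measurable lebesgue. Lp_norm p f < \<infinity>}"

definition strong_frac_maximal ::
  "(real \<Rightarrow> real) \<Rightarrow> (real \<Rightarrow> real) \<Rightarrow> (real \<times> real \<Rightarrow> real) \<Rightarrow> real \<times> real \<Rightarrow> ennreal" where
  "strong_frac_maximal \<alpha> \<beta> f = (\<lambda>(x, y).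
     SUP (I, J) \<in> {(I, J). I \<in> bounded_intervals \<and> J \<in> bounded_intervals \<and> x \<in> I \<and> y \<in> J}.
       ennreal (measure lebesgue I powr (\<alpha> x - 1) * measure lebesgue J powr (\<beta> y - 1)) *
       (\<integral>\<^sup>+ z\<in>I \<times> J. ennreal \<bar>f z\<bar> \<partial>lebesgue))"

definition bounded_Lp_Lvar_weighted ::
  "real \<Rightarrow> ('a::euclidean_space \<Rightarrow> real) \<Rightarrow> ('a \<Rightarrow> real) \<Rightarrow>
     (('a \<Rightarrow> real) \<Rightarrow> 'a \<Rightarrow> ennreal) \<Rightarrow> bool" where
  "bounded_Lp_Lvar_weighted p q v T \<longleftrightarrow>
     (\<exists>c>0. \<forall>f\<in>Lp_space p. Lvar_weighted_norm q v (T f) \<le> ennreal c * Lp_norm p f)"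

end

theory Submission
  imports Defs
begin

text \<open>The testing condition is necessary because of the action of the operator on indicators: if
\<open>f\<close> is the indicator of \<open>R = I \<times> J\<close>, then averaging over \<open>R\<close> itself gives
\<open>M f (s, t) \<ge> |I|^\<alpha>(s) |J|^\<beta>(t)\<close> on \<open>R\<close>, while the \<open>L\<^sup>p\<close> norm of \<open>f\<close> is
\<open>|R|^(1/p)\<close>. This is \<open>testing_constant_finite_if_bounded\<close>.

For the converse, every bounded interval lies in a dyadic window of comparable length
(\<open>interval_subset_dyad\<close>), so that up to the factor 16 the supremum defining \<open>M f\<close> runs over the
countably many rectangles \<open>R = I \<times> J\<close> whose sides are windows. Let the testing constant be less
than \<open>A\<close> and let \<open>f\<close> have norm at most 1. On \<open>R\<close> the term of the supremum that belongs
to \<open>R\<close>, multiplied by \<open>|v| / A\<close>, factors as \<open>\<phi>\<^sub>R T\<^sub>R\<close>, where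
\<open>\<phi>\<^sub>R = |I|\<^sup>\<alpha> |J|\<^sup>\<beta> |v| / (A |R|^(1/p))\<close> is a function and
\<open>T\<^sub>R = |R|^(1/p-1) \<integral>\<^sub>R |f|\<close> is a number. The testing condition says that
\<open>\<phi>\<^sub>R\<close> raised to the power \<open>q\<close> has integral at most 1 over \<open>R\<close>, and the inequality of Hoelder says
that \<open>T\<^sub>R \<le> 1\<close>. The second fact disposes of the variable exponent: fix a constant \<open>q\<^sub>0\<close> with
\<open>p < q\<^sub>0 < q\<^sub>-\<close>; then \<open>T\<^sub>R\<close> raised to the power \<open>q(z)\<close> is at most \<open>T\<^sub>R\<close> raised to the power \<open>q\<^sub>0\<close>.
Replacing the supremum over \<open>R\<close> by the sum over \<open>R\<close> and integrating bounds the modular of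
\<open>M f v / (16 A)\<close> by the sum of \<open>T\<^sub>R\<close> to the power \<open>q\<^sub>0\<close> over all \<open>R\<close>
(\<open>maximal_weighted_norm_le\<close>).

Although every point lies in rectangles of every scale, that sum converges, because \<open>q\<^sub>0 > p\<close>
strictly. In one variable (\<open>carleson_embedding\<close>) the function is cut, for windows of length
comparable to \<open>2\<^sup>k\<close>, at the height \<open>2^(-k/p)\<close>; the parts above and below the cut
are summed over \<open>k\<close> by geometric series that decay on opposite sides of the critical scale. The
embedding for rectangles (\<open>carleson_embedding_product\<close>) is the one-variable embedding applied in
each variable in turn; the two applications fit together by Minkowski's inequality with exponent
\<open>q\<^sub>0 / p > 1\<close> (\<open>minkowski_domination\<close>).\<close>

section \<open>Powers and a Jensen inequality on the extended half-line\<close>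

lemma ennpowr_ennreal: "0 \<le> x \<Longrightarrow> ennpowr (ennreal x) r = ennreal (x powr r)"
  by (simp add: ennpowr_def)

lemma ennpowr_top: "0 < r \<Longrightarrow> ennpowr \<infinity> r = \<infinity>"
  by (simp add: ennpowr_def)

lemma ennpowr_zero [simp]: "ennpowr 0 r = 0"
  by (simp add: ennpowr_def)

lemma ennpowr_one_right [simp]: "ennpowr x 1 = x"
  by (cases x) (simp_all add: ennpowr_def)

lemma ennpowr_one_left [simp]: "ennpowr 1 r = 1"
  using ennpowr_ennreal[of 1 r] by simp

lemma ennpowr_mult:
  assumes "0 < r"
  shows "ennpowr (x * y) r = ennpowr x r * ennpowr y r"
proof (cases x; cases y)
  fix a b assume "x = ennreal a" "0 \<le> a" "y = ennreal b" "0 \<le> b"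
  then show ?thesis
    by (simp add: ennpowr_ennreal powr_mult flip: ennreal_mult)
next
  fix a assume *: "x = ennreal a" "0 \<le> a" "y = top"
  then show ?thesis using assms
    by (cases "a = 0") (auto simp: ennpowr_def ennreal_mult_top)
next
  fix a assume *: "y = ennreal a" "0 \<le> a" "x = top"
  then show ?thesis using assms
    by (cases "a = 0") (auto simp: ennpowr_def ennreal_top_mult)
next
  assume "x = top" "y = top"
  then show ?thesis using assms by (auto simp: ennpowr_def)
qed

lemma ennpowr_mono:
  assumes "0 < r" "x \<le> y"
  shows "ennpowr x r \<le> ennpowr y r"
proof (cases "y = top")
  case True
  then show ?thesis using assms by (simp add: ennpowr_def)
next
  case False
  then obtain a b where "x = ennreal a" "y = ennreal b" "0 \<le> a" "0 \<le> b"
    using assms by (metis ennreal_cases neq_top_trans)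
  then show ?thesis
    using assms by (auto simp: ennpowr_ennreal intro!: ennreal_leI powr_mono2)
qed

lemma ennpowr_ennpowr:
  assumes "0 < a" "0 < b"
  shows "ennpowr (ennpowr x a) b = ennpowr x (a * b)"
  using assms by (cases x) (auto simp: ennpowr_ennreal powr_powr ennpowr_top[simplified])

lemma ennpowr_le_cancel:
  assumes "0 < r" "ennpowr x r \<le> ennpowr y r"
  shows "x \<le> y"
  using ennpowr_mono[of "1/r" "ennpowr x r" "ennpowr y r"] assms
  by (simp add: ennpowr_ennpowr)

lemma ennpowr_antimono_exponent:
  assumes "x \<le> 1" "0 < s" "s \<le> r"
  shows "ennpowr x r \<le> ennpowr x s"
proof -
  obtain a where "x = ennreal a" "0 \<le> a" "a \<le> 1"
    using assms(1) by (cases x) (auto simp: ennreal_le_1 top_unique)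
  then show ?thesis
    using assms by (auto simp: ennpowr_ennreal intro!: ennreal_leI powr_mono')
qed

lemma ennpowr_eq_zero_iff: "0 < r \<Longrightarrow> ennpowr x r = 0 \<longleftrightarrow> x = 0"
  by (cases x) (auto simp: ennpowr_ennreal ennpowr_def)

lemma ennpowr_add_le:
  assumes "0 < r"
  shows "ennpowr (x + y) r \<le> ennreal (2 powr r) * (ennpowr x r + ennpowr y r)"
proof -
  have two: "ennpowr (2 * max x y) r = ennreal (2 powr r) * ennpowr (max x y) r"
    using assms ennpowr_ennreal[of 2 r] by (simp add: ennpowr_mult)
  have "x + y \<le> 2 * max x y"
    by (metis add_mono max.cobounded1 max.cobounded2 mult_2)
  from ennpowr_mono[OF assms this]
  have "ennpowr (x + y) r \<le> ennreal (2 powr r) * ennpowr (max x y) r"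
    by (simp add: two)
  also have "ennpowr (max x y) r \<le> ennpowr x r + ennpowr y r"
    by (auto simp: max_def add_increasing add_increasing2)
  finally show ?thesis
    by (meson mult_left_mono order_trans zero_le)
qed

lemma measurable_ennpowr [measurable]:
  assumes [measurable]: "f \<in> borel_measurable M" "r \<in> borel_measurable M"
  shows "(\<lambda>x. ennpowr (f x) (r x)) \<in> borel_measurable M"
  unfolding ennpowr_def by measurable

text \<open>Jensen's inequality for a measure of total mass at most \<open>m\<close>. It is the integral of Young's inequality
\<open>g / l \<le> (g / l)\<^sup>q / q + 1 - 1 / q\<close>, at the value of \<open>l\<close> for which the right-hand side integrates
to \<open>m\<close>. The version over a set of finite measure serves below as the inequality of Hoelder against the
constant 1.\<close>

lemma ennpowr_integral_le:
  fixes g :: "'a \<Rightarrow> ennreal"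
  assumes q: "1 < q" and [measurable]: "g \<in> borel_measurable M"
    and m: "0 < m" "emeasure M (space M) \<le> ennreal m"
  shows "ennpowr (\<integral>\<^sup>+x. g x \<partial>M) q \<le> ennreal (m powr (q - 1)) * (\<integral>\<^sup>+x. ennpowr (g x) q \<partial>M)"
proof (cases "\<integral>\<^sup>+x. ennpowr (g x) q \<partial>M")
  case top
  then show ?thesis using m by (simp add: ennreal_mult_top)
next
  case (real U)
  show ?thesis
  proof (cases "U = 0")
    case True
    then have "AE x in M. ennpowr (g x) q = 0"
      using real by (simp add: nn_integral_0_iff_AE)
    then have "AE x in M. g x = 0"
      using q by (simp add: ennpowr_eq_zero_iff)
    then have "(\<integral>\<^sup>+x. g x \<partial>M) = 0"
      by (simp add: nn_integral_0_iff_AE)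
    then show ?thesis by simp
  next
    case False
    with real have U: "0 < U" by simp
    define l where "l = (U / m) powr (1/q)"
    have l: "0 < l" "l powr q = U / m" using U m q by (auto simp: l_def powr_powr)
    have young: "g x \<le> ennreal (l * (1 - 1/q)) + ennreal (l powr (1-q) / q) * ennpowr (g x) q" for x
    proof (cases "g x")
      case (real a)
      \<comment> \<open>the conjugate exponent of \<open>q\<close> is \<open>q / (q - 1)\<close>, and the second factor is 1\<close>
      have "a / l * 1 \<le> (a/l) powr q / q + 1 powr (q/(q-1)) / (q/(q-1))"
        by (rule Youngs_inequality) (use q l real in \<open>auto simp: field_simps\<close>)
      then have "a \<le> l * (1 - 1/q) + l * (a/l) powr q / q"
        using l q by (simp add: field_simps)
      also have "l * (a/l) powr q / q = l powr (1-q) / q * a powr q"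
        using l real by (simp add: powr_divide powr_diff)
      finally show ?thesis
        using real l q
        by (simp add: ennpowr_ennreal ennreal_leI flip: ennreal_mult ennreal_plus)
    next
      case top
      then show ?thesis using q l by (simp add: ennpowr_def ennreal_mult_top)
    qed
    have "(\<integral>\<^sup>+x. g x \<partial>M) \<le> (\<integral>\<^sup>+x. ennreal (l * (1 - 1/q)) + ennreal (l powr (1-q) / q) * ennpowr (g x) q \<partial>M)"
      by (intro nn_integral_mono young)
    also have "\<dots> = ennreal (l * (1 - 1/q)) * emeasure M (space M) + ennreal (l powr (1-q) / q) * ennreal U"
      using real by (simp add: nn_integral_add nn_integral_cmult)
    also have "\<dots> \<le> ennreal (l * (1 - 1/q)) * ennreal m + ennreal (l powr (1-q) / q) * ennreal U"
      by (intro add_right_mono mult_left_mono m) auto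
    also have "\<dots> = ennreal (l * (1 - 1/q) * m + l powr (1-q) / q * U)"
      using l q m U by (simp flip: ennreal_mult ennreal_plus)
    also have "l * (1 - 1/q) * m + l powr (1-q) / q * U = l * m"
    proof -
      have "U = l powr q * m" unfolding l(2) using m by simp
      then have "l powr (1-q) / q * U = l / q * m"
        using l q m(1) U by (simp add: powr_diff)
      then show ?thesis by (simp add: algebra_simps)
    qed
    finally have "ennpowr (\<integral>\<^sup>+x. g x \<partial>M) q \<le> ennpowr (ennreal (l * m)) q"
      using q by (intro ennpowr_mono) auto
    also have "\<dots> = ennreal (m powr (q-1) * U)"
      using l m U by (simp add: ennpowr_ennreal powr_mult powr_diff)
    finally show ?thesis
      using real by (simp add: ennreal_mult)
  qed
qed

lemma ennpowr_set_integral_le: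
  fixes g :: "'a \<Rightarrow> ennreal"
  assumes q: "1 < q" and [measurable]: "g \<in> borel_measurable M" "A \<in> sets M"
    and m: "0 < m" "emeasure M A \<le> ennreal m"
  shows "ennpowr (\<integral>\<^sup>+x\<in>A. g x \<partial>M) q \<le> ennreal (m powr (q - 1)) * (\<integral>\<^sup>+x\<in>A. ennpowr (g x) q \<partial>M)"
proof -
  have "emeasure (restrict_space M A) (space (restrict_space M A)) \<le> ennreal m"
    using m by (simp add: space_restrict_space emeasure_restrict_space sets.Int_space_eq2)
  from ennpowr_integral_le[OF q _ m(1) this, of g]
  show ?thesis
    by (simp add: nn_integral_restrict_space measurable_restrict_space1)
qed

text \<open>The terms decrease geometrically as \<open>k\<close> moves down from the last admissible integer, so the sum is
comparable to its largest term, with a constant independent of the real threshold \<open>t\<close>.\<close>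

lemma geometric_sum_below:
  assumes s: "0 < s"
  shows "\<exists>C>0. \<forall>t. (\<integral>\<^sup>+k. ennreal (2 powr (s * real_of_int k)) * indicator {k. of_int k \<le> t} k \<partial>count_space UNIV)
      \<le> ennreal (C * 2 powr (s * t))"
proof (intro exI conjI allI)
  let ?r = "2 powr (- s) :: real"
  have r: "?r < 1" "0 < ?r" using s powr_less_mono[of "-s" 0 "2::real"] by auto
  show "0 < 1 / (1 - ?r)" using r by simp
  fix t :: real
  have bij: "bij_betw (\<lambda>n. \<lfloor>t\<rfloor> - int n) UNIV {k. of_int k \<le> t}"
    by (rule bij_betwI[where g = "\<lambda>k. nat (\<lfloor>t\<rfloor> - k)"]) (auto simp: le_floor_iff intro: order_trans[OF _ of_int_floor_le])
  have "(\<integral>\<^sup>+k. ennreal (2 powr (s * real_of_int k)) * indicator {k. of_int k \<le> t} k \<partial>count_space UNIV)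
     = (\<integral>\<^sup>+k. ennreal (2 powr (s * real_of_int k)) \<partial>count_space {k::int. of_int k \<le> t})"
    by (subst nn_integral_count_space_indicator) auto
  also have "\<dots> = (\<integral>\<^sup>+n. ennreal (2 powr (s * of_int (\<lfloor>t\<rfloor> - int n))) \<partial>count_space UNIV)"
    by (rule nn_integral_bij_count_space[OF bij, symmetric])
  also have "\<dots> = (\<Sum>n. ennreal (2 powr (s * \<lfloor>t\<rfloor>) * ?r ^ n))"
    by (simp add: nn_integral_count_space_nat right_diff_distrib powr_diff powr_minus divide_simps
        power_one_over powr_powr flip: powr_realpow) 
  also have "\<dots> = ennreal (2 powr (s * \<lfloor>t\<rfloor>) * (1 / (1 - ?r)))"
    using r by (intro suminf_ennreal_eq sums_mult geometric_sums) auto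
  also have "\<dots> \<le> ennreal (1 / (1 - ?r) * 2 powr (s * t))"
    using r s by (intro ennreal_leI) (auto simp: mult.commute intro!: divide_right_mono)
  finally show "(\<integral>\<^sup>+k. ennreal (2 powr (s * real_of_int k)) * indicator {k. of_int k \<le> t} k \<partial>count_space UNIV)
     \<le> ennreal (1 / (1 - ?r) * 2 powr (s * t))" .
qed

section \<open>Dyadic windows\<close>

text \<open>The interval belonging to \<open>(k, j)\<close> consists of two adjacent dyadic intervals of length \<open>2\<^sup>k\<close>, and
consecutive intervals overlap by half. A disjoint dyadic grid would not do: a short interval
around a grid point lies in no grid interval of comparable length, whereas one of the overlapping
intervals always contains it.\<close>

definition dyad :: "int \<times> int \<Rightarrow> real set" where
  "dyad = (\<lambda>(k, j). {of_int j * 2 powr of_int k ..< (of_int j + 2) * 2 powr of_int k})"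

definition dlen :: "int \<times> int \<Rightarrow> real" where
  "dlen = (\<lambda>(k, j). 2 * 2 powr of_int k)"

lemma dlen_pos [simp]: "0 < dlen i" "0 \<le> dlen i" "dlen i \<noteq> 0"
  by (auto simp: dlen_def split: prod.split)

lemma borel_dyad [measurable]: "dyad i \<in> sets borel"
  by (auto simp: dyad_def split: prod.split)

lemma emeasure_dyad: "emeasure lborel (dyad i) = ennreal (dlen i)"
  by (cases i) (simp add: dyad_def dlen_def algebra_simps)

lemma measure_dyad: "measure lebesgue (dyad i) = dlen i"
  by (simp add: measure_def emeasure_dyad)

lemma dyad_bounded_interval: "dyad i \<in> bounded_intervals"
  using measure_dyad[of i] dlen_pos(1)[of i]
  by (cases i) (auto simp: bounded_intervals_def dyad_def is_interval_1)

text \<open>Whichever end points belong to \<open>I\<close>, it is squeezed between an open and a closed interval of the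
same measure.\<close>

lemma bounded_interval_endpoints:
  assumes "I \<in> bounded_intervals"
  obtains a b where "a < b" "{a<..<b} \<subseteq> I" "I \<subseteq> {a..b}" "measure lebesgue I = b - a"
proof -
  have I: "is_interval I" "bounded I" "0 < measure lebesgue I"
    using assms by (auto simp: bounded_intervals_def)
  then have ne: "I \<noteq> {}" by auto
  have bdd: "bdd_above I" "bdd_below I"
    using I(2) by (auto simp: bounded_imp_bdd_above bounded_imp_bdd_below)
  define a b where "a = Inf I" and "b = Sup I"
  have sub: "I \<subseteq> {a..b}"
    using bdd by (auto simp: a_def b_def intro: cInf_lower cSup_upper)
  have sup: "{a<..<b} \<subseteq> I"
  proof
    fix x assume "x \<in> {a<..<b}"
    then obtain y z where "y \<in> I" "y < x" "z \<in> I" "x < z"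
      using ne bdd by (auto simp: a_def b_def cInf_less_iff less_cSup_iff)
    then show "x \<in> I"
      using I(1) unfolding is_interval_1 by (meson less_eq_real_def)
  qed
  have meas: "I \<in> lmeasurable"
    using I by (intro measurable_convex) (auto simp: is_interval_convex)
  have ab: "a \<le> b" using ne sub by force
  have le: "b - a \<le> measure lebesgue I"
    using measure_mono_fmeasurable[OF sup _ meas] ab by simp
  have ge: "measure lebesgue I \<le> b - a"
    using measure_mono_fmeasurable[OF sub, of lebesgue] meas ab by (simp add: fmeasurableD)
  show thesis
    by (rule that[of a b]) (use I(3) le ge sup sub in auto)
qed

text \<open>Choose \<open>k\<close> with \<open>2^(k-1) < |I| \<le> 2\<^sup>k\<close>, and let \<open>j 2\<^sup>k\<close> be the last grid point up to
the left end of \<open>I\<close>; then \<open>I\<close> ends before \<open>(j + 2) 2\<^sup>k\<close>.\<close>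

lemma interval_subset_dyad:
  assumes "I \<in> bounded_intervals"
  shows "\<exists>i. I \<subseteq> dyad i \<and> dlen i \<le> 4 * measure lebesgue I"
proof -
  obtain a b where ab: "a < b" "I \<subseteq> {a..b}" "measure lebesgue I = b - a"
    using bounded_interval_endpoints[OF assms] by metis
  define m where "m = measure lebesgue I"
  have m: "m = b - a" "0 < m" using ab by (auto simp: m_def)
  define k where "k = \<lceil>log 2 m\<rceil>"
  define j where "j = \<lfloor>a / 2 powr k\<rfloor>"
  have "2 powr log 2 m \<le> 2 powr real_of_int k"
    by (simp add: k_def)
  then have k1: "m \<le> 2 powr k" using m by simp
  have "2 powr real_of_int k \<le> 2 powr (log 2 m + 1)"
    unfolding k_def by (intro powr_mono) linarith+
  then have k2: "2 powr k \<le> 2 * m" using m by (simp add: powr_add)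
  have "real_of_int j \<le> a / 2 powr k" "a / 2 powr k < real_of_int j + 1"
    unfolding j_def by linarith+
  then have j: "j * 2 powr k \<le> a" "a < (real_of_int j + 1) * 2 powr k"
    by (auto simp: field_simps)
  have "(real_of_int j + 2) * 2 powr real_of_int k = (real_of_int j + 1) * 2 powr k + 2 powr k"
    by (simp add: algebra_simps)
  then have "b < (real_of_int j + 2) * 2 powr k"
    using j k1 m by linarith
  then have "I \<subseteq> dyad (k, j)"
    using ab(2) j by (force simp: dyad_def)
  moreover have "dlen (k, j) \<le> 4 * measure lebesgue I"
    using k2 by (simp add: dlen_def m_def)
  ultimately show ?thesis by blast
qed

lemma sum_indicator_dyad:
  "(\<integral>\<^sup>+j. indicator (dyad (k, j)) x \<partial>count_space UNIV) = (2::ennreal)"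
proof -
  define n where "n = \<lfloor>x / 2 powr k\<rfloor>"
  have n: "n * 2 powr k \<le> x" "x < (real_of_int n + 1) * 2 powr k"
    using floor_divide_lower[of "2 powr k" x] floor_divide_upper[of "2 powr k" x] by (auto simp: n_def)
  have "x \<in> dyad (k, j) \<longleftrightarrow> j = n \<or> j = n - 1" for j
  proof -
    have "j * 2 powr k \<le> x \<longleftrightarrow> j \<le> n"
      by (simp add: n_def le_floor_iff field_simps)
    moreover have "x < (real_of_int j + 2) * 2 powr k \<longleftrightarrow> n < j + 2"
      by (simp add: n_def floor_less_iff field_simps)
    ultimately show ?thesis by (auto simp: dyad_def)
  qed
  then have "(\<lambda>j. indicator (dyad (k, j)) x :: ennreal) = indicator {n - 1, n}"
    by (auto simp: indicator_def fun_eq_iff)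
  then show ?thesis
    by (simp add: emeasure_count_space)
qed

lemma sum_integral_dyad:
  assumes [measurable]: "u \<in> borel_measurable borel"
  shows "(\<integral>\<^sup>+j. (\<integral>\<^sup>+x\<in>dyad (k, j). u x \<partial>lborel) \<partial>count_space UNIV) = 2 * (\<integral>\<^sup>+x. u x \<partial>lborel)"
proof -
  have "(\<integral>\<^sup>+j. (\<integral>\<^sup>+x\<in>dyad (k, j). u x \<partial>lborel) \<partial>count_space UNIV)
      = (\<integral>\<^sup>+x. (\<integral>\<^sup>+j. u x * indicator (dyad (k, j)) x \<partial>count_space UNIV) \<partial>lborel)"
    by (rule nn_integral_count_space_nn_integral[symmetric]) auto
  also have "\<dots> = (\<integral>\<^sup>+x. 2 * u x \<partial>lborel)"
    by (simp add: nn_integral_cmult sum_indicator_dyad mult.commute)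
  finally show ?thesis by (simp add: nn_integral_cmult)
qed

section \<open>The embedding of the window averages in one variable\<close>

text \<open>A value \<open>a\<close> exceeds the height \<open>2^(-k/p)\<close> exactly when \<open>-k < p log\<^sub>2 a\<close>, and the factor
\<open>2^(k(1/p-1))\<close> decays as \<open>k\<close> grows. Hence the critical scale dominates, and it
contributes \<open>a^(p-1) a\<close>.\<close>

lemma sum_levels_above:
  assumes p: "1 < p"
  shows "\<exists>C>0. \<forall>a::ennreal. (\<integral>\<^sup>+k. ennreal (2 powr (real_of_int k * (1/p - 1))) *
      (a * indicator {k. ennreal (2 powr (- real_of_int k / p)) < a} k) \<partial>count_space UNIV) \<le> ennreal C * ennpowr a p"
proof -
  define s where "s = 1 - 1/p"
  have s: "0 < s" using p by (simp add: s_def)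
  obtain C where C: "0 < C" "\<And>t. (\<integral>\<^sup>+k. ennreal (2 powr (s * real_of_int k)) * indicator {k. of_int k \<le> t} k \<partial>count_space UNIV)
      \<le> ennreal (C * 2 powr (s * t))"
    using geometric_sum_below[OF s] by blast
  have "(\<integral>\<^sup>+k. ennreal (2 powr (real_of_int k * (1/p - 1))) *
      (a * indicator {k. ennreal (2 powr (- real_of_int k / p)) < a} k) \<partial>count_space UNIV) \<le> ennreal C * ennpowr a p" for a
  proof (cases a)
    case (real x)
    show ?thesis
    proof (cases "x = 0")
      case True
      then show ?thesis using real by simp
    next
      case False
      then have x: "0 < x" using real by simp
      have iff: "- real_of_int k \<le> p * log 2 x" if "ennreal (2 powr (- real_of_int k / p)) < a" for k
      proof -
        have "2 powr (- real_of_int k / p) < x" using that real by (simp add: ennreal_less_iff)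
        then have "- real_of_int k / p < log 2 x" using x by (simp add: less_log_iff)
        then show ?thesis using p by (simp add: field_simps)
      qed
      have "(\<integral>\<^sup>+k. ennreal (2 powr (real_of_int k * (1/p - 1))) *
          (a * indicator {k. ennreal (2 powr (- real_of_int k / p)) < a} k) \<partial>count_space UNIV)
        \<le> (\<integral>\<^sup>+k. a * (ennreal (2 powr (s * real_of_int (- k))) *
           indicator {k. real_of_int k \<le> p * log 2 x} (- k)) \<partial>count_space UNIV)"
      proof (rule nn_integral_mono)
        fix k :: int
        show "ennreal (2 powr (real_of_int k * (1/p - 1))) *
            (a * indicator {k. ennreal (2 powr (- real_of_int k / p)) < a} k)
          \<le> a * (ennreal (2 powr (s * real_of_int (- k))) *
           indicator {k. real_of_int k \<le> p * log 2 x} (- k))"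
          using iff[of k] by (auto simp: indicator_def s_def algebra_simps)
      qed
      also have "\<dots> = a * (\<integral>\<^sup>+k. (ennreal (2 powr (s * real_of_int (- k))) *
           indicator {k. real_of_int k \<le> p * log 2 x} (- k)) \<partial>count_space UNIV)"
        by (simp add: nn_integral_cmult)
      also have "(\<integral>\<^sup>+k. (ennreal (2 powr (s * real_of_int (- k))) *
           indicator {k. real_of_int k \<le> p * log 2 x} (- k)) \<partial>count_space UNIV)
        = (\<integral>\<^sup>+k. (ennreal (2 powr (s * real_of_int k)) *
           indicator {k. real_of_int k \<le> p * log 2 x} k) \<partial>count_space UNIV)"
        by (rule nn_integral_bij_count_space[where g = uminus]) (auto intro!: bij_betwI[where g = uminus])
      also have "\<dots> \<le> ennreal (C * 2 powr (s * (p * log 2 x)))" by (rule C)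
      also have "2 powr (s * (p * log 2 x)) = x powr (p - 1)"
      proof -
        have "s * (p * log 2 x) = log 2 x * (p - 1)" using p by (simp add: s_def field_simps)
        then have "2 powr (s * (p * log 2 x)) = (2 powr log 2 x) powr (p - 1)"
          by (simp only: powr_powr)
        then show ?thesis using x by simp
      qed
      also have "a * ennreal (C * x powr (p - 1)) = ennreal C * ennpowr a p"
        using real x C(1) by (simp add: ennpowr_ennreal powr_diff flip: ennreal_mult)
      finally show ?thesis by (simp add: mult_left_mono)
    qed
  next
    case top
    then show ?thesis using C p by (simp add: ennpowr_def ennreal_mult_top)
  qed
  with C(1) show ?thesis by blast
qed

text \<open>The counterpart for the values below the height: here \<open>k \<le> -p log\<^sub>2 a\<close>, and because \<open>q > p\<close>
the factor decays as \<open>k\<close> decreases. The critical scale contributes \<open>a^(p-q) a\<^sup>q\<close>.\<close>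

lemma sum_levels_below:
  assumes p: "1 < p" "p < q"
  shows "\<exists>C>0. \<forall>a::ennreal. (\<integral>\<^sup>+k. ennreal (2 powr (real_of_int k * (q/p - 1))) *
      ennpowr (a * indicator {k. a \<le> ennreal (2 powr (- real_of_int k / p))} k) q \<partial>count_space UNIV) \<le> ennreal C * ennpowr a p"
proof -
  define s where "s = q/p - 1"
  have s: "0 < s" using p by (simp add: s_def)
  obtain C where C: "0 < C" "\<And>t. (\<integral>\<^sup>+k. ennreal (2 powr (s * real_of_int k)) * indicator {k. of_int k \<le> t} k \<partial>count_space UNIV)
      \<le> ennreal (C * 2 powr (s * t))"
    using geometric_sum_below[OF s] by blast
  have "(\<integral>\<^sup>+k. ennreal (2 powr (real_of_int k * (q/p - 1))) *
      ennpowr (a * indicator {k. a \<le> ennreal (2 powr (- real_of_int k / p))} k) q \<partial>count_space UNIV) \<le> ennreal C * ennpowr a p" for a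
  proof (cases a)
    case (real x)
    show ?thesis
    proof (cases "x = 0")
      case True
      then show ?thesis using real by simp
    next
      case False
      then have x: "0 < x" using real by simp
      have iff: "real_of_int k \<le> - p * log 2 x" if "a \<le> ennreal (2 powr (- real_of_int k / p))" for k
      proof -
        have "x \<le> 2 powr (- real_of_int k / p)" using that real by (simp add: ennreal_le_iff)
        then have "log 2 x \<le> - real_of_int k / p" using x by (simp add: log_le_iff)
        then show ?thesis using p by (simp add: field_simps)
      qed
      have "(\<integral>\<^sup>+k. ennreal (2 powr (real_of_int k * (q/p - 1))) *
          ennpowr (a * indicator {k. a \<le> ennreal (2 powr (- real_of_int k / p))} k) q \<partial>count_space UNIV)
        \<le> (\<integral>\<^sup>+k. ennpowr a q * (ennreal (2 powr (s * real_of_int k)) *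
           indicator {k. real_of_int k \<le> - p * log 2 x} k) \<partial>count_space UNIV)"
      proof (rule nn_integral_mono)
        fix k :: int
        show "ennreal (2 powr (real_of_int k * (q/p - 1))) *
            ennpowr (a * indicator {k. a \<le> ennreal (2 powr (- real_of_int k / p))} k) q
          \<le> ennpowr a q * (ennreal (2 powr (s * real_of_int k)) *
           indicator {k. real_of_int k \<le> - p * log 2 x} k)"
          using iff[of k] by (auto simp: indicator_def s_def mult.commute)
      qed
      also have "\<dots> = ennpowr a q * (\<integral>\<^sup>+k. (ennreal (2 powr (s * real_of_int k)) *
           indicator {k. real_of_int k \<le> - p * log 2 x} k) \<partial>count_space UNIV)"
        by (simp add: nn_integral_cmult)
      also have "\<dots> \<le> ennpowr a q * ennreal (C * 2 powr (s * (- p * log 2 x)))"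
        by (intro mult_left_mono C) auto
      also have "2 powr (s * (- p * log 2 x)) = x powr (p - q)"
      proof -
        have "s * (- p * log 2 x) = log 2 x * (p - q)" using p by (simp add: s_def field_simps)
        then show ?thesis using x by (simp flip: powr_powr)
      qed
      also have "ennpowr a q * ennreal (C * x powr (p - q)) = ennreal C * ennpowr a p"
        using real x C(1) by (simp add: ennpowr_ennreal powr_diff flip: ennreal_mult)
      finally show ?thesis .
    qed
  next
    case top
    then show ?thesis using C p by (simp add: ennpowr_def ennreal_mult_top)
  qed
  with C(1) show ?thesis by blast
qed

text \<open>At scale \<open>k\<close> split \<open>g\<close> into \<open>g1\<close>, its values above \<open>2^(-k/p)\<close>, and \<open>g2\<close>, the remaining
ones. The normalized averages \<open>a k j\<close> of \<open>g1\<close> are at most 1, so their \<open>q\<close>-th powers are at most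
themselves and one is left with a sum of integrals of \<open>g1\<close>. The \<open>q\<close>-th powers of the averages
\<open>b k j\<close> of \<open>g2\<close> are estimated by Jensen's inequality. In both cases the sum over the positions
\<open>j\<close> costs the overlap 2, and the sum over the scales \<open>k\<close> is taken pointwise under the integral.\<close>

lemma carleson_embedding_normalized:
  assumes p: "1 < p" "p < q"
  shows "\<exists>C>0. \<forall>g\<in>borel_measurable borel. (\<integral>\<^sup>+x. ennpowr (g x) p \<partial>lborel) \<le> 1 \<longrightarrow>
    (\<integral>\<^sup>+i. ennpowr (ennreal (dlen i powr (1/p - 1)) * (\<integral>\<^sup>+x\<in>dyad i. g x \<partial>lborel)) q \<partial>count_space UNIV)
      \<le> ennreal C"
proof -
  obtain C1 where C1: "0 < C1" "\<And>a::ennreal. (\<integral>\<^sup>+k. ennreal (2 powr (real_of_int k * (1/p - 1))) *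
      (a * indicator {k. ennreal (2 powr (- real_of_int k / p)) < a} k) \<partial>count_space UNIV) \<le> ennreal C1 * ennpowr a p"
    using sum_levels_above[OF p(1)] by blast
  obtain C2 where C2: "0 < C2" "\<And>a::ennreal. (\<integral>\<^sup>+k. ennreal (2 powr (real_of_int k * (q/p - 1))) *
      ennpowr (a * indicator {k. a \<le> ennreal (2 powr (- real_of_int k / p))} k) q \<partial>count_space UNIV) \<le> ennreal C2 * ennpowr a p"
    using sum_levels_below[OF p] by blast
  have q: "1 < q" "0 < q" using p by auto
  define C where "C = 2 powr q * (2 * C1 + 2 powr (q/p) * C2)"
  have "0 < C" using C1 C2 by (auto simp: C_def intro!: mult_pos_pos add_pos_pos)
  moreover have "(\<integral>\<^sup>+i. ennpowr (ennreal (dlen i powr (1/p - 1)) * (\<integral>\<^sup>+x\<in>dyad i. g x \<partial>lborel)) q \<partial>count_space UNIV)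
      \<le> ennreal C" if [measurable]: "g \<in> borel_measurable borel" and g: "(\<integral>\<^sup>+x. ennpowr (g x) p \<partial>lborel) \<le> 1" for g
  proof -
    define l where "l k = 2 powr (- real_of_int k / p)" for k
    have l: "0 < l k" for k by (simp add: l_def)
    define g1 where "g1 k x = g x * indicator {k. ennreal (l k) < g x} k" for k x
    define g2 where "g2 k x = g x * indicator {k. g x \<le> ennreal (l k)} k" for k x
    have [measurable]: "g1 k \<in> borel_measurable borel" "g2 k \<in> borel_measurable borel" for k
      unfolding g1_def g2_def indicator_def by measurable
    have gsum: "g x = g1 k x + g2 k x" for k x
      by (auto simp: g1_def g2_def indicator_def)
    define w where "w k = 2 powr (real_of_int k + 1)" for k :: int
    have wpos: "0 < w k" for k by (simp add: w_def)
    have dlen: "dlen (k, j) = w k" for k j by (simp add: dlen_def w_def powr_add)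
    define a where "a k j = ennreal (w k powr (1/p - 1)) * (\<integral>\<^sup>+x\<in>dyad (k, j). g1 k x \<partial>lborel)" for k j
    define b where "b k j = ennreal (w k powr (1/p - 1)) * (\<integral>\<^sup>+x\<in>dyad (k, j). g2 k x \<partial>lborel)" for k j
    have ab: "ennreal (dlen (k, j) powr (1/p - 1)) * (\<integral>\<^sup>+x\<in>dyad (k, j). g x \<partial>lborel) = a k j + b k j" for k j
      by (subst gsum[of _ k]) (simp add: a_def b_def dlen distrib_right nn_integral_add distrib_left)
    have a_le: "ennpowr (a k j) q \<le> a k j" for k j
    proof -
      have pt: "g1 k x \<le> ennreal (l k powr (1 - p)) * ennpowr (g x) p" for x
      proof (cases "ennreal (l k) < g x")
        case True
        show ?thesis
        proof (cases "g x")
          case (real y)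
          with True l[of k] have y: "l k < y" "0 < y" by (auto simp: ennreal_less_iff)
          then have "y = y powr (1 - p) * y powr p" by (simp flip: powr_add)
          also have "\<dots> \<le> l k powr (1 - p) * y powr p"
            using y p l[of k] by (intro mult_right_mono powr_mono2') auto
          finally show ?thesis
            using real y by (simp add: g1_def indicator_def ennpowr_ennreal ennreal_leI flip: ennreal_mult)
        next
          case top
          then show ?thesis using l[of k] p by (simp add: ennpowr_def ennreal_mult_top)
        qed
      next
        case False
        then show ?thesis by (simp add: g1_def)
      qed
      have "(\<integral>\<^sup>+x\<in>dyad (k, j). g1 k x \<partial>lborel) \<le> (\<integral>\<^sup>+x. g1 k x \<partial>lborel)"
        by (intro nn_integral_mono) (auto simp: indicator_def)
      also have "\<dots> \<le> (\<integral>\<^sup>+x. ennreal (l k powr (1 - p)) * ennpowr (g x) p \<partial>lborel)"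
        by (intro nn_integral_mono pt)
      also have "\<dots> = ennreal (l k powr (1 - p)) * (\<integral>\<^sup>+x. ennpowr (g x) p \<partial>lborel)"
        by (simp add: nn_integral_cmult)
      also have "\<dots> \<le> ennreal (l k powr (1 - p)) * 1"
        by (intro mult_left_mono g) auto
      finally have "a k j \<le> ennreal (w k powr (1/p - 1)) * ennreal (l k powr (1 - p))"
        by (simp add: a_def mult_left_mono)
      also have "\<dots> = ennreal (2 powr (1/p - 1))"
      proof -
        have "w k powr (1/p - 1) * l k powr (1 - p) = 2 powr (1/p - 1)"
        proof -
          have "(real_of_int k + 1) * (1/p - 1) + (- real_of_int k / p) * (1 - p) = 1/p - 1"
            using p by (simp add: divide_simps) (simp add: algebra_simps)
          then show ?thesis by (simp only: w_def l_def powr_powr flip: powr_add)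
        qed
        then show ?thesis by (simp flip: ennreal_mult)
      qed
      also have "\<dots> \<le> 1"
        using p powr_mono[of "1/p - 1" 0 "2::real"] by (simp add: ennreal_le_1)
      finally show ?thesis
        using ennpowr_antimono_exponent[of "a k j" 1 q] q by simp
    qed
    have sum_a: "(\<integral>\<^sup>+k. (\<integral>\<^sup>+j. ennpowr (a k j) q \<partial>count_space UNIV) \<partial>count_space UNIV) \<le> ennreal (2 * C1)"
    proof -
      have "(\<integral>\<^sup>+j. ennpowr (a k j) q \<partial>count_space UNIV)
         \<le> 2 * (\<integral>\<^sup>+x. ennreal (2 powr (real_of_int k * (1/p - 1))) * g1 k x \<partial>lborel)" for k
      proof -
        have "(\<integral>\<^sup>+j. ennpowr (a k j) q \<partial>count_space UNIV) \<le> (\<integral>\<^sup>+j. a k j \<partial>count_space UNIV)"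
          by (intro nn_integral_mono a_le)
        also have "\<dots> = ennreal (w k powr (1/p - 1)) * (2 * (\<integral>\<^sup>+x. g1 k x \<partial>lborel))"
          by (simp add: a_def nn_integral_cmult sum_integral_dyad)
        also have "\<dots> \<le> ennreal (2 powr (real_of_int k * (1/p - 1))) * (2 * (\<integral>\<^sup>+x. g1 k x \<partial>lborel))"
          using p by (intro mult_right_mono ennreal_leI) (auto simp: w_def powr_powr divide_simps)
        also have "\<dots> = 2 * (\<integral>\<^sup>+x. ennreal (2 powr (real_of_int k * (1/p - 1))) * g1 k x \<partial>lborel)"
          by (simp add: nn_integral_cmult mult.left_commute)
        finally show ?thesis .
      qed
      then have "(\<integral>\<^sup>+k. (\<integral>\<^sup>+j. ennpowr (a k j) q \<partial>count_space UNIV) \<partial>count_space UNIV)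
        \<le> (\<integral>\<^sup>+k. 2 * (\<integral>\<^sup>+x. ennreal (2 powr (real_of_int k * (1/p - 1))) * g1 k x \<partial>lborel) \<partial>count_space UNIV)"
        by (intro nn_integral_mono)
      also have "\<dots> = 2 * (\<integral>\<^sup>+x. (\<integral>\<^sup>+k. ennreal (2 powr (real_of_int k * (1/p - 1))) * g1 k x \<partial>count_space UNIV) \<partial>lborel)"
        by (subst nn_integral_count_space_nn_integral) (auto simp: nn_integral_cmult)
      also have "\<dots> \<le> 2 * (\<integral>\<^sup>+x. ennreal C1 * ennpowr (g x) p \<partial>lborel)"
        unfolding g1_def l_def by (intro mult_left_mono nn_integral_mono C1) auto
      also have "\<dots> \<le> 2 * (ennreal C1 * 1)"
        by (simp add: nn_integral_cmult del: mult_1_right) (intro mult_left_mono g, auto)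
      finally show ?thesis using C1 by (simp add: ennreal_mult)
    qed
    have b_le: "ennpowr (b k j) q \<le> ennreal (w k powr (q/p - 1)) * (\<integral>\<^sup>+x\<in>dyad (k, j). ennpowr (g2 k x) q \<partial>lborel)" for k j
    proof -
      have "ennpowr (\<integral>\<^sup>+x\<in>dyad (k, j). g2 k x \<partial>lborel) q
          \<le> ennreal (w k powr (q - 1)) * (\<integral>\<^sup>+x\<in>dyad (k, j). ennpowr (g2 k x) q \<partial>lborel)"
        using wpos by (intro ennpowr_set_integral_le) (use q in \<open>auto simp: emeasure_dyad dlen\<close>)
      then have "ennpowr (b k j) q \<le> ennpowr (ennreal (w k powr (1/p - 1))) q *
          (ennreal (w k powr (q - 1)) * (\<integral>\<^sup>+x\<in>dyad (k, j). ennpowr (g2 k x) q \<partial>lborel))"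
        using q by (simp add: b_def ennpowr_mult mult_left_mono)
      also have "ennpowr (ennreal (w k powr (1/p - 1))) q * (ennreal (w k powr (q - 1)) * y) = ennreal (w k powr (q/p - 1)) * y" for y
      proof -
        have "(w k powr (1/p - 1)) powr q * w k powr (q - 1) = w k powr (q/p - 1)"
          by (simp only: powr_powr flip: powr_add) (simp add: algebra_simps)
        then show ?thesis by (simp add: ennpowr_ennreal flip: ennreal_mult mult.assoc)
      qed
      finally show ?thesis .
    qed
    have sum_b: "(\<integral>\<^sup>+k. (\<integral>\<^sup>+j. ennpowr (b k j) q \<partial>count_space UNIV) \<partial>count_space UNIV) \<le> ennreal (2 powr (q/p) * C2)"
    proof -
      have "(\<integral>\<^sup>+j. ennpowr (b k j) q \<partial>count_space UNIV)
         \<le> ennreal (2 powr (q/p)) * (\<integral>\<^sup>+x. ennreal (2 powr (real_of_int k * (q/p - 1))) * ennpowr (g2 k x) q \<partial>lborel)" for k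
      proof -
        have "(\<integral>\<^sup>+j. ennpowr (b k j) q \<partial>count_space UNIV)
          \<le> (\<integral>\<^sup>+j. ennreal (w k powr (q/p - 1)) * (\<integral>\<^sup>+x\<in>dyad (k, j). ennpowr (g2 k x) q \<partial>lborel) \<partial>count_space UNIV)"
          by (intro nn_integral_mono b_le)
        also have "\<dots> = ennreal (w k powr (q/p - 1)) * (ennreal 2 * (\<integral>\<^sup>+x. ennpowr (g2 k x) q \<partial>lborel))"
          by (simp add: nn_integral_cmult sum_integral_dyad)
        also have "\<dots> = (ennreal (w k powr (q/p - 1)) * ennreal 2) * (\<integral>\<^sup>+x. ennpowr (g2 k x) q \<partial>lborel)"
          by (simp add: mult.assoc)
        also have "ennreal (w k powr (q/p - 1)) * ennreal 2 = ennreal (2 powr (q/p)) * ennreal (2 powr (real_of_int k * (q/p - 1)))"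
        proof -
          have "w k powr (q/p - 1) * 2 powr 1 = 2 powr (q/p) * 2 powr (real_of_int k * (q/p - 1))"
            by (simp only: w_def powr_powr flip: powr_add) (simp add: algebra_simps)
          then show ?thesis by (subst (1 2) ennreal_mult[symmetric]) auto
        qed
        finally show ?thesis by (simp add: nn_integral_cmult mult.assoc)
      qed
      then have "(\<integral>\<^sup>+k. (\<integral>\<^sup>+j. ennpowr (b k j) q \<partial>count_space UNIV) \<partial>count_space UNIV)
        \<le> (\<integral>\<^sup>+k. ennreal (2 powr (q/p)) * (\<integral>\<^sup>+x. ennreal (2 powr (real_of_int k * (q/p - 1))) * ennpowr (g2 k x) q \<partial>lborel) \<partial>count_space UNIV)"
        by (intro nn_integral_mono)
      also have "\<dots> = ennreal (2 powr (q/p)) * (\<integral>\<^sup>+x. (\<integral>\<^sup>+k. ennreal (2 powr (real_of_int k * (q/p - 1))) * ennpowr (g2 k x) q \<partial>count_space UNIV) \<partial>lborel)"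
        by (subst nn_integral_count_space_nn_integral) (auto simp: nn_integral_cmult)
      also have "\<dots> \<le> ennreal (2 powr (q/p)) * (\<integral>\<^sup>+x. ennreal C2 * ennpowr (g x) p \<partial>lborel)"
        unfolding g2_def l_def by (intro mult_left_mono nn_integral_mono C2) auto
      also have "\<dots> \<le> ennreal (2 powr (q/p)) * (ennreal C2 * 1)"
        by (simp add: nn_integral_cmult del: mult_1_right) (intro mult_left_mono g, auto)
      finally show ?thesis using C2 by (simp add: ennreal_mult)
    qed
    have "(\<integral>\<^sup>+i. ennpowr (ennreal (dlen i powr (1/p - 1)) * (\<integral>\<^sup>+x\<in>dyad i. g x \<partial>lborel)) q \<partial>count_space UNIV)
      = (\<integral>\<^sup>+k. (\<integral>\<^sup>+j. ennpowr (a k j + b k j) q \<partial>count_space UNIV) \<partial>count_space UNIV)"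
      by (subst nn_integral_fst_count_space[symmetric]) (simp add: ab)
    also have "\<dots> \<le> (\<integral>\<^sup>+k. (\<integral>\<^sup>+j. ennreal (2 powr q) * (ennpowr (a k j) q + ennpowr (b k j) q) \<partial>count_space UNIV) \<partial>count_space UNIV)"
      using q by (intro nn_integral_mono ennpowr_add_le) auto
    also have "\<dots> = ennreal (2 powr q) * ((\<integral>\<^sup>+k. (\<integral>\<^sup>+j. ennpowr (a k j) q \<partial>count_space UNIV) \<partial>count_space UNIV)
        + (\<integral>\<^sup>+k. (\<integral>\<^sup>+j. ennpowr (b k j) q \<partial>count_space UNIV) \<partial>count_space UNIV))"
      by (simp add: nn_integral_cmult nn_integral_add)
    also have "\<dots> \<le> ennreal (2 powr q) * (ennreal (2 * C1) + ennreal (2 powr (q/p) * C2))"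
      by (intro mult_left_mono add_mono sum_a sum_b) auto
    also have "\<dots> = ennreal C"
      using C1 C2 by (simp add: C_def flip: ennreal_mult ennreal_plus)
    finally show ?thesis .
  qed
  ultimately show ?thesis by blast
qed

text \<open>Removal of the normalization by homogeneity. The norm zero is treated separately because it
cannot be scaled to 1.\<close>

lemma carleson_embedding:
  assumes p: "1 < p" "p < q"
  shows "\<exists>C>0. \<forall>g\<in>borel_measurable borel.
    (\<integral>\<^sup>+i. ennpowr (ennreal (dlen i powr (1/p - 1)) * (\<integral>\<^sup>+x\<in>dyad i. g x \<partial>lborel)) q \<partial>count_space UNIV)
      \<le> ennreal C * ennpowr (\<integral>\<^sup>+x. ennpowr (g x) p \<partial>lborel) (q/p)"
proof -
  obtain C where C: "0 < C" "\<And>g. g \<in> borel_measurable borel \<Longrightarrow> (\<integral>\<^sup>+x. ennpowr (g x) p \<partial>lborel) \<le> 1 \<Longrightarrow>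
    (\<integral>\<^sup>+i. ennpowr (ennreal (dlen i powr (1/p - 1)) * (\<integral>\<^sup>+x\<in>dyad i. g x \<partial>lborel)) q \<partial>count_space UNIV)
      \<le> ennreal C"
    using carleson_embedding_normalized[OF p] by blast
  have "(\<integral>\<^sup>+i. ennpowr (ennreal (dlen i powr (1/p - 1)) * (\<integral>\<^sup>+x\<in>dyad i. g x \<partial>lborel)) q \<partial>count_space UNIV)
      \<le> ennreal C * ennpowr (\<integral>\<^sup>+x. ennpowr (g x) p \<partial>lborel) (q/p)" (is "?S g \<le> _")
    if [measurable]: "g \<in> borel_measurable borel" for g
  proof (cases "\<integral>\<^sup>+x. ennpowr (g x) p \<partial>lborel")
    case top
    then show ?thesis using C p by (simp add: ennpowr_def ennreal_mult_top)
  next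
    case (real N)
    show ?thesis
    proof (cases "N = 0")
      case True
      then have "AE x in lborel. ennpowr (g x) p = 0"
        using real by (simp add: nn_integral_0_iff_AE)
      then have "AE x in lborel. g x = 0" using p by (simp add: ennpowr_eq_zero_iff)
      then have "(\<integral>\<^sup>+x\<in>dyad i. g x \<partial>lborel) = 0" for i
        by (subst nn_integral_0_iff_AE) auto
      then show ?thesis by simp
    next
      case False
      then have N: "0 < N" using real by simp
      define c where "c = N powr (1/p)"
      have c: "0 < c" using N by (simp add: c_def)
      define h where "h x = ennreal (1/c) * g x" for x
      have [measurable]: "h \<in> borel_measurable borel" unfolding h_def by measurable
      have "(\<integral>\<^sup>+x. ennpowr (h x) p \<partial>lborel) = ennreal ((1/c) powr p) * ennreal N"
        using p c real by (simp add: h_def ennpowr_mult nn_integral_cmult ennpowr_ennreal)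
      also have "\<dots> = 1"
        using p N by (simp add: c_def powr_powr powr_divide flip: ennreal_mult)
      finally have "?S h \<le> ennreal C" by (intro C) auto
      moreover have "g x = ennreal c * h x" for x
        using c by (simp add: h_def flip: ennreal_mult mult.assoc)
      then have "?S g = ennreal (c powr q) * ?S h"
        using p c by (simp add: nn_integral_cmult ennpowr_mult mult.assoc mult.left_commute ennpowr_ennreal)
      ultimately have "?S g \<le> ennreal (c powr q) * ennreal C"
        by (simp add: mult_left_mono)
      also have "\<dots> = ennreal C * ennpowr (ennreal N) (q/p)"
        using N by (simp add: c_def powr_powr ennpowr_ennreal mult.commute)
      finally show ?thesis using real by simp
    qed
  qed
  with C(1) show ?thesis by blast
qed

section \<open>The embedding for rectangles\<close>

text \<open>Minkowski's inequality for \<open>\<ell>\<^sup>r\<close>-valued functions, for a family whose \<open>\<ell>\<^sup>r\<close> norm at \<open>x\<close> is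
bounded by a multiple of \<open>h x\<close>. Writing \<open>w i = h u i\<close>, the claim becomes Jensen's inequality
for each \<open>u i\<close> with respect to the measure of density \<open>h\<close>, whose mass is at most 1, followed by an
interchange of sum and integral.\<close>

lemma minkowski_domination:
  fixes w :: "'i::countable \<Rightarrow> 'a \<Rightarrow> ennreal"
  assumes r: "1 < r" and [measurable]: "\<And>i. w i \<in> borel_measurable M" "h \<in> borel_measurable M"
    and h: "(\<integral>\<^sup>+x. h x \<partial>M) \<le> 1"
    and dom: "\<And>x. (\<integral>\<^sup>+i. ennpowr (w i x) r \<partial>count_space UNIV) \<le> ennreal C * ennpowr (h x) r"
  shows "(\<integral>\<^sup>+i. ennpowr (\<integral>\<^sup>+x. w i x \<partial>M) r \<partial>count_space UNIV) \<le> ennreal C"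
proof -
  define u where "u i x = inverse (h x) * w i x" for i x
  have [measurable]: "u i \<in> borel_measurable M" for i unfolding u_def by measurable
  have fin: "AE x in M. h x \<noteq> \<infinity>"
    using h by (intro nn_integral_noteq_infinite) (auto simp: top_unique)
  have w_eq: "w i x = h x * u i x" if finx: "h x \<noteq> \<infinity>" for i x
  proof (cases "h x = 0")
    case True
    have "ennpowr (w i x) r \<le> (\<integral>\<^sup>+i. ennpowr (w i x) r \<partial>count_space UNIV)"
      by (rule nn_integral_ge_point) simp
    also have "\<dots> = 0" using dom[of x] True by simp
    finally show ?thesis using r True by (simp add: ennpowr_eq_zero_iff)
  next
    case False
    then obtain y where y: "h x = ennreal y" "0 < y"
      using finx by (cases "h x") (auto simp: less_le)
    then show ?thesis
      by (simp add: u_def inverse_ennreal flip: mult.assoc ennreal_mult)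
  qed
  have u_le: "h x * (\<integral>\<^sup>+i. ennpowr (u i x) r \<partial>count_space UNIV) \<le> h x * ennreal C" if finx: "h x \<noteq> \<infinity>" for x
  proof (cases "h x = 0")
    case False
    then obtain y where y: "h x = ennreal y" "0 < y"
      using finx by (cases "h x") (auto simp: less_le)
    have "(\<integral>\<^sup>+i. ennpowr (u i x) r \<partial>count_space UNIV)
        = ennreal ((inverse y) powr r) * (\<integral>\<^sup>+i. ennpowr (w i x) r \<partial>count_space UNIV)"
      using y r by (simp add: u_def ennpowr_mult inverse_ennreal ennpowr_ennreal nn_integral_cmult)
    also have "\<dots> \<le> ennreal ((inverse y) powr r) * (ennreal C * ennpowr (h x) r)"
      by (intro mult_left_mono dom) auto
    also have "\<dots> = (ennreal ((inverse y) powr r) * ennreal (y powr r)) * ennreal C"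
      using y by (simp add: ennpowr_ennreal mult_ac)
    also have "ennreal ((inverse y) powr r) * ennreal (y powr r) = 1"
      using y by (simp flip: ennreal_mult powr_mult)
    finally show ?thesis by (simp add: mult_left_mono)
  qed simp
  have each: "ennpowr (\<integral>\<^sup>+x. w i x \<partial>M) r \<le> (\<integral>\<^sup>+x. h x * ennpowr (u i x) r \<partial>M)" for i
  proof -
    have "(\<integral>\<^sup>+x. w i x \<partial>M) = (\<integral>\<^sup>+x. h x * u i x \<partial>M)"
      by (rule nn_integral_cong_AE) (use fin w_eq in auto)
    also have "\<dots> = (\<integral>\<^sup>+x. u i x \<partial>density M h)"
      by (simp add: nn_integral_density)
    also have "ennpowr \<dots> r \<le> ennreal (1 powr (r - 1)) * (\<integral>\<^sup>+x. ennpowr (u i x) r \<partial>density M h)"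
      using h by (intro ennpowr_integral_le r) (auto simp: emeasure_density cong: nn_integral_cong)
    also have "\<dots> = (\<integral>\<^sup>+x. h x * ennpowr (u i x) r \<partial>M)"
      by (simp add: nn_integral_density)
    finally show ?thesis .
  qed
  have "(\<integral>\<^sup>+i. ennpowr (\<integral>\<^sup>+x. w i x \<partial>M) r \<partial>count_space UNIV)
     \<le> (\<integral>\<^sup>+i. (\<integral>\<^sup>+x. h x * ennpowr (u i x) r \<partial>M) \<partial>count_space UNIV)"
    by (intro nn_integral_mono each)
  also have "\<dots> = (\<integral>\<^sup>+x. (\<integral>\<^sup>+i. h x * ennpowr (u i x) r \<partial>count_space UNIV) \<partial>M)"
    by (rule nn_integral_count_space_nn_integral[symmetric]) auto
  also have "\<dots> = (\<integral>\<^sup>+x. h x * (\<integral>\<^sup>+i. ennpowr (u i x) r \<partial>count_space UNIV) \<partial>M)"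
    by (simp add: nn_integral_cmult)
  also have "\<dots> \<le> (\<integral>\<^sup>+x. h x * ennreal C \<partial>M)"
    by (rule nn_integral_mono_AE) (use fin u_le in auto)
  also have "\<dots> \<le> 1 * ennreal C"
    using h by (simp add: nn_integral_multc mult_right_mono del: mult_1_left)
  finally show ?thesis by simp
qed

text \<open>For a fixed window \<open>dyad j\<close> in the second variable let \<open>F j x\<close> be the normalized average of
\<open>f (x, _)\<close> over it. The normalized average over a rectangle is the one-variable average of \<open>F j\<close>,
so the embedding in \<open>x\<close> leaves the numbers \<open>\<integral> (F j x)\<^sup>p dx\<close> to be summed in \<open>\<ell>^(q/p)\<close>. By
Minkowski's inequality it suffices to do this for fixed \<open>x\<close>, where it is the embedding in \<open>y\<close>.\<close>

lemma carleson_embedding_product: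
  assumes p: "1 < p" "p < q"
  shows "\<exists>C>0. \<forall>f\<in>borel_measurable borel. (\<integral>\<^sup>+z. ennpowr (f z) p \<partial>lborel) \<le> 1 \<longrightarrow>
    (\<integral>\<^sup>+(i, j). ennpowr (ennreal ((dlen i * dlen j) powr (1/p - 1)) *
       (\<integral>\<^sup>+z\<in>dyad i \<times> dyad j. f z \<partial>lborel)) q \<partial>count_space UNIV) \<le> ennreal C"
proof -
  obtain C where C: "0 < C" "\<And>g. g \<in> borel_measurable borel \<Longrightarrow>
    (\<integral>\<^sup>+i. ennpowr (ennreal (dlen i powr (1/p - 1)) * (\<integral>\<^sup>+x\<in>dyad i. g x \<partial>lborel)) q \<partial>count_space UNIV)
      \<le> ennreal C * ennpowr (\<integral>\<^sup>+x. ennpowr (g x) p \<partial>lborel) (q/p)"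
    using carleson_embedding[OF p] by blast
  have "(\<integral>\<^sup>+(i, j). ennpowr (ennreal ((dlen i * dlen j) powr (1/p - 1)) *
       (\<integral>\<^sup>+z\<in>dyad i \<times> dyad j. f z \<partial>lborel)) q \<partial>count_space UNIV) \<le> ennreal (C * C)"
    if f[measurable]: "f \<in> borel_measurable borel" and f1: "(\<integral>\<^sup>+z. ennpowr (f z) p \<partial>lborel) \<le> 1"
    for f :: "real \<times> real \<Rightarrow> ennreal"
  proof -
    have [measurable]: "f \<in> borel_measurable (lborel \<Otimes>\<^sub>M lborel)"
      using f by (simp add: lborel_prod)
    define F where "F j x = ennreal (dlen j powr (1/p - 1)) * (\<integral>\<^sup>+y\<in>dyad j. f (x, y) \<partial>lborel)" for j x
    define h where "h x = (\<integral>\<^sup>+y. ennpowr (f (x, y)) p \<partial>lborel)" for x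
    have [measurable]: "F j \<in> borel_measurable borel" for j
      unfolding F_def by measurable
    have [measurable]: "h \<in> borel_measurable borel"
      unfolding h_def by measurable
    have h: "(\<integral>\<^sup>+x. h x \<partial>lborel) \<le> 1"
    proof -
      have "(\<integral>\<^sup>+x. h x \<partial>lborel) = (\<integral>\<^sup>+z. ennpowr (f z) p \<partial>(lborel \<Otimes>\<^sub>M lborel))"
        unfolding h_def by (rule lborel.nn_integral_fst) measurable
      then show ?thesis using f1 by (simp add: lborel_prod)
    qed
    have iter: "ennreal ((dlen i * dlen j) powr (1/p - 1)) * (\<integral>\<^sup>+z\<in>dyad i \<times> dyad j. f z \<partial>lborel)
        = ennreal (dlen i powr (1/p - 1)) * (\<integral>\<^sup>+x\<in>dyad i. F j x \<partial>lborel)" for i j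
    proof -
      have "(\<integral>\<^sup>+z\<in>dyad i \<times> dyad j. f z \<partial>lborel) = (\<integral>\<^sup>+z\<in>dyad i \<times> dyad j. f z \<partial>(lborel \<Otimes>\<^sub>M lborel))"
        by (simp only: lborel_prod)
      also have "\<dots> = (\<integral>\<^sup>+x. (\<integral>\<^sup>+y. f (x, y) * indicator (dyad i \<times> dyad j) (x, y) \<partial>lborel) \<partial>lborel)"
        by (rule lborel.nn_integral_fst[symmetric]) measurable
      also have "\<dots> = (\<integral>\<^sup>+x. (\<integral>\<^sup>+y\<in>dyad j. f (x, y) \<partial>lborel) * indicator (dyad i) x \<partial>lborel)"
        by (simp add: indicator_times mult_ac nn_integral_cmult)
      finally show ?thesis
        by (simp add: F_def nn_integral_cmult powr_mult mult.assoc ennreal_mult)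
    qed
    have "(\<integral>\<^sup>+(i, j). ennpowr (ennreal ((dlen i * dlen j) powr (1/p - 1)) *
         (\<integral>\<^sup>+z\<in>dyad i \<times> dyad j. f z \<partial>lborel)) q \<partial>count_space UNIV)
      = (\<integral>\<^sup>+j. (\<integral>\<^sup>+i. ennpowr (ennreal (dlen i powr (1/p - 1)) * (\<integral>\<^sup>+x\<in>dyad i. F j x \<partial>lborel)) q \<partial>count_space UNIV) \<partial>count_space UNIV)"
      by (subst nn_integral_snd_count_space[symmetric]) (simp add: iter)
    also have "\<dots> \<le> (\<integral>\<^sup>+j. ennreal C * ennpowr (\<integral>\<^sup>+x. ennpowr (F j x) p \<partial>lborel) (q/p) \<partial>count_space UNIV)"
      by (intro nn_integral_mono C) auto
    also have "\<dots> = ennreal C * (\<integral>\<^sup>+j. ennpowr (\<integral>\<^sup>+x. ennpowr (F j x) p \<partial>lborel) (q/p) \<partial>count_space UNIV)"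
      by (simp add: nn_integral_cmult)
    also have "\<dots> \<le> ennreal C * ennreal C"
    proof (rule mult_left_mono)
      show "(\<integral>\<^sup>+j. ennpowr (\<integral>\<^sup>+x. ennpowr (F j x) p \<partial>lborel) (q/p) \<partial>count_space UNIV) \<le> ennreal C"
      proof (rule minkowski_domination[where h = h])
        fix x
        have "(\<integral>\<^sup>+j. ennpowr (F j x) q \<partial>count_space UNIV) \<le> ennreal C * ennpowr (h x) (q/p)"
          unfolding F_def h_def by (rule C) measurable
        then show "(\<integral>\<^sup>+j. ennpowr (ennpowr (F j x) p) (q/p) \<partial>count_space UNIV) \<le> ennreal C * ennpowr (h x) (q/p)"
          using p by (simp add: ennpowr_ennpowr)
      qed (use p h in auto)
    qed simp
    finally show ?thesis using C(1) by (simp add: ennreal_mult)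
  qed
  moreover have "0 < C * C" using C by simp
  ultimately show ?thesis by blast
qed

section \<open>Rectangles and coordinates for Lebesgue measure\<close>

lemma bounded_interval_borel:
  assumes "I \<in> bounded_intervals"
  shows "I \<in> sets borel"
proof -
  obtain a b where ab: "{a<..<b} \<subseteq> I" "I \<subseteq> {a..b}"
    using bounded_interval_endpoints[OF assms] by metis
  then have "I = {a<..<b} \<union> (I \<inter> {a, b})" by force
  moreover have "I \<inter> {a, b} \<in> sets borel"
    by (intro borel_closed finite_imp_closed) auto
  ultimately show ?thesis
    by (metis borel_open open_greaterThanLessThan sets.Un)
qed

lemma emeasure_bounded_interval:
  assumes "I \<in> bounded_intervals"
  shows "emeasure lborel I = ennreal (measure lebesgue I)"
proof -
  have "I \<in> lmeasurable"
    using assms by (intro measurable_convex) (auto simp: is_interval_convex bounded_intervals_def)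
  then have "emeasure lebesgue I = ennreal (measure lebesgue I)"
    by (intro emeasure_eq_measure2) (auto simp: fmeasurable_def)
  then show ?thesis
    using bounded_interval_borel[OF assms] by simp
qed

lemma emeasure_rectangle:
  assumes "I \<in> bounded_intervals" "J \<in> bounded_intervals"
  shows "emeasure lborel (I \<times> J) = ennreal (measure lebesgue I * measure lebesgue J)"
proof -
  have "emeasure (lborel \<Otimes>\<^sub>M lborel) (I \<times> J) = emeasure lborel I * emeasure lborel J"
    using assms by (intro lborel.emeasure_pair_measure_Times) (auto simp: bounded_interval_borel)
  then show ?thesis
    using assms by (simp add: lborel_prod emeasure_bounded_interval ennreal_mult)
qed

lemma borel_rectangle:
  assumes "I \<in> bounded_intervals" "J \<in> bounded_intervals"
  shows "I \<times> J \<in> sets borel"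
  using assms by (intro borel_Times bounded_interval_borel)

lemma measure_rectangle:
  assumes "I \<in> bounded_intervals" "J \<in> bounded_intervals"
  shows "measure lebesgue (I \<times> J) = measure lebesgue I * measure lebesgue J"
  using assms borel_rectangle[OF assms] by (simp add: measure_def emeasure_rectangle)

text \<open>Measurability between completed measures asks that preimages of null sets be null. Applied to
the two coordinate projections this makes \<open>\<alpha>(x)\<close> and \<open>\<beta>(y)\<close> Lebesgue measurable functions on the
plane, as the interchange of sums and integrals below requires.\<close>

lemma measurable_lebesgue_lebesgueI:
  fixes f :: "'a::euclidean_space \<Rightarrow> 'b::euclidean_space"
  assumes f: "f \<in> borel_measurable borel"
    and null: "\<And>A. A \<in> null_sets lborel \<Longrightarrow> f -` A \<in> null_sets lborel"
  shows "f \<in> lebesgue \<rightarrow>\<^sub>M lebesgue"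
proof (rule completion.measurable_completion2)
  show meas: "f \<in> lebesgue \<rightarrow>\<^sub>M lborel"
    using f by (intro measurable_completion) simp
  show "null_sets lborel \<subseteq> null_sets (distr lebesgue lborel f)"
  proof
    fix A :: "'b set" assume A: "A \<in> null_sets lborel"
    then have "f -` A \<in> null_sets lebesgue"
      by (intro null_sets_completionI null)
    then show "A \<in> null_sets (distr lebesgue lborel f)"
      using A meas by (auto simp: null_sets_def emeasure_distr)
  qed
qed

lemma fst_lebesgue: "fst \<in> (lebesgue :: (real \<times> real) measure) \<rightarrow>\<^sub>M lebesgue"
proof (rule measurable_lebesgue_lebesgueI)
  show "fst -` A \<in> null_sets (lborel :: (real \<times> real) measure)" if "A \<in> null_sets lborel" for A :: "real set"
  proof -
    have A: "A \<in> sets borel" "emeasure lborel A = 0" using that by (auto simp: null_sets_def)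
    have "emeasure (lborel \<Otimes>\<^sub>M lborel) (A \<times> (UNIV :: real set)) = emeasure lborel A * emeasure lborel (UNIV :: real set)"
      by (intro lborel.emeasure_pair_measure_Times) (use A in auto)
    then have "A \<times> (UNIV :: real set) \<in> null_sets lborel"
      using A by (auto simp: null_sets_def lborel_prod intro!: borel_Times)
    then show ?thesis by (simp add: fst_vimage_eq_Times)
  qed
qed (simp add: borel_measurable_continuous_onI continuous_on_fst)

lemma snd_lebesgue: "snd \<in> (lebesgue :: (real \<times> real) measure) \<rightarrow>\<^sub>M lebesgue"
proof (rule measurable_lebesgue_lebesgueI)
  show "snd -` A \<in> null_sets (lborel :: (real \<times> real) measure)" if "A \<in> null_sets lborel" for A :: "real set"
  proof -
    have A: "A \<in> sets borel" "emeasure lborel A = 0" using that by (auto simp: null_sets_def)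
    have "emeasure (lborel \<Otimes>\<^sub>M lborel) ((UNIV :: real set) \<times> A) = emeasure lborel (UNIV :: real set) * emeasure lborel A"
      by (intro lborel.emeasure_pair_measure_Times) (use A in auto)
    then have "(UNIV :: real set) \<times> A \<in> null_sets lborel"
      using A by (auto simp: null_sets_def lborel_prod intro!: borel_Times)
    then show ?thesis by (simp add: snd_vimage_eq_Times)
  qed
qed (simp add: borel_measurable_continuous_onI continuous_on_snd)

section \<open>The testing condition implies boundedness\<close>

text \<open>Passing to windows at most four times as long enlarges the integral, and since the exponents
\<open>a - 1\<close> and \<open>b - 1\<close> lie between -1 and 0, it decreases each power by a factor of at most 4.\<close>

lemma rectangle_average_le_dyadic:
  assumes I: "I \<in> bounded_intervals" and J: "J \<in> bounded_intervals"
    and a: "0 \<le> a" "a \<le> 1" and b: "0 \<le> b" "b \<le> 1"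
  shows "\<exists>i j. I \<times> J \<subseteq> dyad i \<times> dyad j \<and>
    ennreal (measure lebesgue I powr (a - 1) * measure lebesgue J powr (b - 1)) * (\<integral>\<^sup>+z\<in>I \<times> J. F z \<partial>lebesgue)
    \<le> 16 * (ennreal (dlen i powr (a - 1) * dlen j powr (b - 1)) * (\<integral>\<^sup>+z\<in>dyad i \<times> dyad j. F z \<partial>lebesgue))"
proof -
  have len: "measure lebesgue K powr (c - 1) \<le> 4 * dlen k powr (c - 1)"
    if c: "0 \<le> c" "c \<le> 1" and k: "dlen k \<le> 4 * measure lebesgue K" for K c k
  proof -
    have "measure lebesgue K powr (c - 1) \<le> (dlen k / 4) powr (c - 1)"
      using k c dlen_pos(1)[of k] by (intro powr_mono2') auto
    also have "\<dots> = 4 powr (1 - c) * dlen k powr (c - 1)"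
      using powr_minus[of 4 "c - 1"] by (simp add: powr_divide field_simps)
    also have "\<dots> \<le> 4 * dlen k powr (c - 1)"
      using c powr_mono[of "1 - c" 1 "4::real"] by (intro mult_right_mono) auto
    finally show ?thesis .
  qed
  obtain i where i: "I \<subseteq> dyad i" "dlen i \<le> 4 * measure lebesgue I"
    using interval_subset_dyad[OF I] by blast
  obtain j where j: "J \<subseteq> dyad j" "dlen j \<le> 4 * measure lebesgue J"
    using interval_subset_dyad[OF J] by blast
  have sub: "I \<times> J \<subseteq> dyad i \<times> dyad j" using i j by blast
  have "measure lebesgue I powr (a - 1) * measure lebesgue J powr (b - 1)
      \<le> (4 * dlen i powr (a - 1)) * (4 * dlen j powr (b - 1))"
    using len[OF a i(2)] len[OF b j(2)] by (intro mult_mono) auto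
  then have "ennreal (measure lebesgue I powr (a - 1) * measure lebesgue J powr (b - 1))
      \<le> ennreal (16 * (dlen i powr (a - 1) * dlen j powr (b - 1)))"
    by (intro ennreal_leI) (simp add: mult_ac)
  moreover have "(\<integral>\<^sup>+z\<in>I \<times> J. F z \<partial>lebesgue) \<le> (\<integral>\<^sup>+z\<in>dyad i \<times> dyad j. F z \<partial>lebesgue)"
    using sub by (intro nn_integral_mono mult_left_mono) (auto simp: indicator_def)
  ultimately have "ennreal (measure lebesgue I powr (a - 1) * measure lebesgue J powr (b - 1)) * (\<integral>\<^sup>+z\<in>I \<times> J. F z \<partial>lebesgue)
    \<le> ennreal (16 * (dlen i powr (a - 1) * dlen j powr (b - 1))) * (\<integral>\<^sup>+z\<in>dyad i \<times> dyad j. F z \<partial>lebesgue)"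
    by (intro mult_mono) auto
  also have "\<dots> = 16 * (ennreal (dlen i powr (a - 1) * dlen j powr (b - 1)) * (\<integral>\<^sup>+z\<in>dyad i \<times> dyad j. F z \<partial>lebesgue))"
    by (simp add: ennreal_mult mult.assoc)
  finally show ?thesis using sub by blast
qed

text \<open>The estimate of the modular that was described at the beginning. The function \<open>S\<close> is the sum of the
terms \<open>\<phi>\<^sub>R^q T\<^sub>R^q\<^sub>0\<close> divided by \<open>C\<close>; it dominates the \<open>q\<close>-th power of the weighted maximal
function divided by \<open>l = 16 A C N\<close>, and its integral is at most 1. The maximal function itself is only compared
pointwise with \<open>S\<close>; sums and integrals are interchanged for \<open>S\<close>, whose terms are measurable.\<close>

lemma maximal_weighted_norm_le:
  fixes q v :: "real \<times> real \<Rightarrow> real"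
  assumes p: "1 < p" "p < q0" and q0: "\<And>z. q0 \<le> q z"
    and meas: "q \<in> borel_measurable lebesgue" "v \<in> borel_measurable lebesgue"
      "\<alpha> \<in> borel_measurable lebesgue" "\<beta> \<in> borel_measurable lebesgue"
    and \<alpha>: "\<And>x. 0 \<le> \<alpha> x" "\<And>x. \<alpha> x \<le> 1" and \<beta>: "\<And>x. 0 \<le> \<beta> x" "\<And>x. \<beta> x \<le> 1"
    and A: "0 < A" and cond: "\<And>i j. (\<integral>\<^sup>+z\<in>dyad i \<times> dyad j.
        ennpowr (ennreal (dlen i powr \<alpha> (fst z) * dlen j powr \<beta> (snd z) * \<bar>v z\<bar> / (A * (dlen i * dlen j) powr (1/p)))) (q z) \<partial>lebesgue) \<le> 1"
    and C: "\<And>f. f \<in> borel_measurable borel \<Longrightarrow> (\<integral>\<^sup>+z. ennpowr (f z) p \<partial>lborel) \<le> 1 \<Longrightarrow>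
      (\<integral>\<^sup>+(i, j). ennpowr (ennreal ((dlen i * dlen j) powr (1/p - 1)) *
       (\<integral>\<^sup>+z\<in>dyad i \<times> dyad j. f z \<partial>lborel)) q0 \<partial>count_space UNIV) \<le> ennreal C" and C1: "1 \<le> C"
    and f: "f \<in> borel_measurable lebesgue" and N: "0 < N" "(\<integral>\<^sup>+z. ennreal (\<bar>f z\<bar> powr p) \<partial>lebesgue) \<le> ennreal (N powr p)"
  shows "Lvar_weighted_norm q v (strong_frac_maximal \<alpha> \<beta> f) \<le> ennreal (16 * A * C * N)"
proof -
  note [measurable] = meas f
  have [measurable]: "(\<lambda>z::real \<times> real. \<alpha> (fst z)) \<in> borel_measurable lebesgue" "(\<lambda>z::real \<times> real. \<beta> (snd z)) \<in> borel_measurable lebesgue"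
    using measurable_compose[OF fst_lebesgue meas(3)] measurable_compose[OF snd_lebesgue meas(4)] by auto
  have qpos: "0 < q z" "1 < q z" for z using q0[of z] p by auto
  \<comment> \<open>Tonelli's theorem applies to Borel functions, and changing \<open>f\<close> on a null set changes no average.\<close>
  obtain f' where f'[measurable]: "f' \<in> borel_measurable borel" and ae: "AE z in lborel. f z = f' z"
    using completion_ex_borel_measurable_real[OF f] by auto
  define g where "g z = ennreal (\<bar>f' z\<bar> / N)" for z
  have [measurable]: "g \<in> borel_measurable borel" unfolding g_def by measurable
  have g1: "(\<integral>\<^sup>+z. ennpowr (g z) p \<partial>lborel) \<le> 1"
  proof -
    have "(\<integral>\<^sup>+z. ennpowr (g z) p \<partial>lborel) = (\<integral>\<^sup>+z. ennreal (1 / N powr p) * ennreal (\<bar>f' z\<bar> powr p) \<partial>lborel)"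
      using N by (intro nn_integral_cong) (simp add: g_def ennpowr_ennreal powr_divide flip: ennreal_mult)
    also have "\<dots> = ennreal (1 / N powr p) * (\<integral>\<^sup>+z. ennreal (\<bar>f' z\<bar> powr p) \<partial>lborel)"
      by (simp add: nn_integral_cmult)
    also have "(\<integral>\<^sup>+z. ennreal (\<bar>f' z\<bar> powr p) \<partial>lborel) = (\<integral>\<^sup>+z. ennreal (\<bar>f z\<bar> powr p) \<partial>lebesgue)"
      unfolding nn_integral_completion by (rule nn_integral_cong_AE) (use ae in auto)
    also have "ennreal (1 / N powr p) * \<dots> \<le> ennreal (1 / N powr p) * ennreal (N powr p)"
      by (intro mult_left_mono N) auto
    also have "\<dots> = 1" using N by (simp flip: ennreal_mult)
    finally show ?thesis .
  qed
  have int_f: "(\<integral>\<^sup>+z\<in>dyad i \<times> dyad j. ennreal \<bar>f z\<bar> \<partial>lebesgue) = ennreal N * (\<integral>\<^sup>+z\<in>dyad i \<times> dyad j. g z \<partial>lborel)" for i j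
  proof -
    have "(\<integral>\<^sup>+z\<in>dyad i \<times> dyad j. ennreal \<bar>f z\<bar> \<partial>lebesgue) = (\<integral>\<^sup>+z\<in>dyad i \<times> dyad j. ennreal \<bar>f' z\<bar> \<partial>lborel)"
      unfolding nn_integral_completion by (rule nn_integral_cong_AE) (use ae in auto)
    also have "\<dots> = (\<integral>\<^sup>+z. ennreal N * (g z * indicator (dyad i \<times> dyad j) z) \<partial>lborel)"
      using N by (intro nn_integral_cong) (auto simp: g_def indicator_def simp flip: ennreal_mult)
    also have "\<dots> = ennreal N * (\<integral>\<^sup>+z\<in>dyad i \<times> dyad j. g z \<partial>lborel)"
      by (rule nn_integral_cmult) (auto intro!: borel_measurable_times_ennreal borel_measurable_indicator borel_Times)
    finally show ?thesis .
  qed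
  define T where "T i j = ennreal ((dlen i * dlen j) powr (1/p - 1)) * (\<integral>\<^sup>+z\<in>dyad i \<times> dyad j. g z \<partial>lborel)" for i j
  have T_sum: "(\<integral>\<^sup>+(i, j). ennpowr (T i j) q0 \<partial>count_space UNIV) \<le> ennreal C"
    unfolding T_def by (rule C) (use g1 in auto)
  have T1: "T i j \<le> 1" for i j
  proof -
    have R: "0 < dlen i * dlen j" by simp
    have "ennpowr (\<integral>\<^sup>+z\<in>dyad i \<times> dyad j. g z \<partial>lborel) p
        \<le> ennreal ((dlen i * dlen j) powr (p - 1)) * (\<integral>\<^sup>+z\<in>dyad i \<times> dyad j. ennpowr (g z) p \<partial>lborel)"
      using R emeasure_rectangle[OF dyad_bounded_interval dyad_bounded_interval, of i j]
      by (intro ennpowr_set_integral_le p) (auto simp: measure_dyad intro!: borel_Times)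
    also have "\<dots> \<le> ennreal ((dlen i * dlen j) powr (p - 1)) * 1"
    proof (rule mult_left_mono)
      have "(\<integral>\<^sup>+z\<in>dyad i \<times> dyad j. ennpowr (g z) p \<partial>lborel) \<le> (\<integral>\<^sup>+z. ennpowr (g z) p \<partial>lborel)"
        by (intro nn_integral_mono) (auto simp: indicator_def)
      with g1 show "(\<integral>\<^sup>+z\<in>dyad i \<times> dyad j. ennpowr (g z) p \<partial>lborel) \<le> 1" by simp
    qed simp
    finally have "ennpowr (T i j) p \<le> ennpowr (ennreal ((dlen i * dlen j) powr (1/p - 1))) p * ennreal ((dlen i * dlen j) powr (p - 1))"
      using p by (simp add: T_def ennpowr_mult mult_left_mono)
    also have "\<dots> = ennreal (((dlen i * dlen j) powr (1/p - 1)) powr p * (dlen i * dlen j) powr (p - 1))"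
      by (simp add: ennpowr_ennreal ennreal_mult)
    also have "((dlen i * dlen j) powr (1/p - 1)) powr p * (dlen i * dlen j) powr (p - 1) = 1"
    proof -
      have "(1/p - 1) * p + (p - 1) = 0" using p by (simp add: algebra_simps)
      then show ?thesis using R by (simp only: powr_powr flip: powr_add) simp
    qed
    finally have "ennpowr (T i j) p \<le> ennpowr 1 p" by simp
    then show ?thesis using p ennpowr_le_cancel[of p] by simp
  qed
  define \<phi> where "\<phi> i j z = ennreal (dlen i powr \<alpha> (fst z) * dlen j powr \<beta> (snd z) * \<bar>v z\<bar> / (A * (dlen i * dlen j) powr (1/p))) * indicator (dyad i \<times> dyad j) z" for i j z
  have [measurable]: "dyad i \<times> dyad j \<in> sets lebesgue" for i j
    by (intro sets_completionI_sets) (auto intro: borel_Times)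
  have [measurable]: "\<phi> i j \<in> borel_measurable lebesgue" for i j
    unfolding \<phi>_def by measurable
  have \<phi>1: "(\<integral>\<^sup>+z. ennpowr (\<phi> i j z) (q z) \<partial>lebesgue) \<le> 1" for i j
  proof -
    have "(\<integral>\<^sup>+z. ennpowr (\<phi> i j z) (q z) \<partial>lebesgue) = (\<integral>\<^sup>+z\<in>dyad i \<times> dyad j.
        ennpowr (ennreal (dlen i powr \<alpha> (fst z) * dlen j powr \<beta> (snd z) * \<bar>v z\<bar> / (A * (dlen i * dlen j) powr (1/p)))) (q z) \<partial>lebesgue)"
      by (intro nn_integral_cong) (auto simp: \<phi>_def indicator_def)
    then show ?thesis using cond[of i j] by simp
  qed
  define S where "S z = ennreal (1 / C) * (\<integral>\<^sup>+(i, j). ennpowr (\<phi> i j z) (q z) * ennpowr (T i j) q0 \<partial>count_space UNIV)" for z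
  define l where "l = 16 * A * C * N"
  have l: "0 < l" using A C1 N by (simp add: l_def)
  have point: "ennpowr (strong_frac_maximal \<alpha> \<beta> f z * ennreal \<bar>v z\<bar> / ennreal l) (q z) \<le> S z" for z
  proof -
    obtain x y where z: "z = (x, y)" by (cases z)
    define c where "c = ennreal (\<bar>v z\<bar> / l)"
    have each: "c * (ennreal (measure lebesgue I powr (\<alpha> x - 1) * measure lebesgue J powr (\<beta> y - 1)) *
        (\<integral>\<^sup>+ z\<in>I \<times> J. ennreal \<bar>f z\<bar> \<partial>lebesgue)) \<le> ennpowr (S z) (1 / q z)"
      if IJ: "I \<in> bounded_intervals" "J \<in> bounded_intervals" "x \<in> I" "y \<in> J" for I J
    proof -
      obtain i j where ij: "I \<times> J \<subseteq> dyad i \<times> dyad j"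
        and le: "ennreal (measure lebesgue I powr (\<alpha> x - 1) * measure lebesgue J powr (\<beta> y - 1)) * (\<integral>\<^sup>+ z\<in>I \<times> J. ennreal \<bar>f z\<bar> \<partial>lebesgue)
          \<le> 16 * (ennreal (dlen i powr (\<alpha> x - 1) * dlen j powr (\<beta> y - 1)) * (\<integral>\<^sup>+ z\<in>dyad i \<times> dyad j. ennreal \<bar>f z\<bar> \<partial>lebesgue))"
        using rectangle_average_le_dyadic[OF IJ(1,2) \<alpha>(1)[of x] \<alpha>(2)[of x] \<beta>(1)[of y] \<beta>(2)[of y],
          where F = "\<lambda>z. ennreal \<bar>f z\<bar>"] by (elim exE conjE)
      have in_R: "z \<in> dyad i \<times> dyad j" using ij IJ z by auto
      have real_eq: "\<bar>v z\<bar> / l * (16 * (dlen i powr (\<alpha> x - 1) * dlen j powr (\<beta> y - 1) * N))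
          = 1 / C * (dlen i powr \<alpha> x * dlen j powr \<beta> y * \<bar>v z\<bar> / (A * (dlen i * dlen j) powr (1/p))) * (dlen i * dlen j) powr (1/p - 1)"
        using A N C1 by (simp add: l_def powr_diff powr_mult field_simps)
      have "c * (16 * (ennreal (dlen i powr (\<alpha> x - 1) * dlen j powr (\<beta> y - 1)) * (\<integral>\<^sup>+ z\<in>dyad i \<times> dyad j. ennreal \<bar>f z\<bar> \<partial>lebesgue)))
        = ennreal (\<bar>v z\<bar> / l * (16 * (dlen i powr (\<alpha> x - 1) * dlen j powr (\<beta> y - 1) * N))) * (\<integral>\<^sup>+z\<in>dyad i \<times> dyad j. g z \<partial>lborel)"
      proof -
        have "ennreal (\<bar>v z\<bar> / l * (16 * (dlen i powr (\<alpha> x - 1) * dlen j powr (\<beta> y - 1) * N)))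
            = c * ennreal (16 * (dlen i powr (\<alpha> x - 1) * dlen j powr (\<beta> y - 1) * N))"
          unfolding c_def using l N(1) by (intro ennreal_mult) auto
        also have "\<dots> = c * (16 * (ennreal (dlen i powr (\<alpha> x - 1) * dlen j powr (\<beta> y - 1)) * ennreal N))"
          using N(1) by (simp add: ennreal_mult)
        finally show ?thesis by (simp only: int_f mult.assoc)
      qed
      also have "\<dots> = ennreal (1 / C) * (\<phi> i j z * T i j)"
      proof -
        define r where "r = dlen i powr \<alpha> x * dlen j powr \<beta> y * \<bar>v z\<bar> / (A * (dlen i * dlen j) powr (1/p))"
        have "0 \<le> r" using A by (simp add: r_def)
        moreover have "\<phi> i j z = ennreal r"
          using in_R z by (simp add: \<phi>_def r_def)
        ultimately show ?thesis
          unfolding real_eq r_def[symmetric] T_def using C1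
          by (simp only: ennreal_mult powr_ge_zero mult.assoc mult_nonneg_nonneg zero_le_divide_1_iff)
      qed
      finally have eq: "c * (16 * (ennreal (dlen i powr (\<alpha> x - 1) * dlen j powr (\<beta> y - 1)) * (\<integral>\<^sup>+ z\<in>dyad i \<times> dyad j. ennreal \<bar>f z\<bar> \<partial>lebesgue)))
        = ennreal (1 / C) * (\<phi> i j z * T i j)" .
      have "ennpowr (ennreal (1 / C) * (\<phi> i j z * T i j)) (q z)
          = ennpowr (ennreal (1 / C)) (q z) * (ennpowr (\<phi> i j z) (q z) * ennpowr (T i j) (q z))"
        using qpos by (simp add: ennpowr_mult)
      \<comment> \<open>Both \<open>1 / C\<close> and \<open>T i j\<close> are at most 1, so lowering their exponents increases the powers.\<close>
      also have "\<dots> \<le> ennpowr (ennreal (1 / C)) 1 * (ennpowr (\<phi> i j z) (q z) * ennpowr (T i j) q0)"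
        using C1 p q0[of z] qpos[of z] T1
        by (intro mult_mono[OF ennpowr_antimono_exponent mult_left_mono[OF ennpowr_antimono_exponent]]) auto
      also have "\<dots> \<le> S z"
      proof -
        have "(case (i, j) of (i, j) \<Rightarrow> ennpowr (\<phi> i j z) (q z) * ennpowr (T i j) q0)
          \<le> (\<integral>\<^sup>+(i, j). ennpowr (\<phi> i j z) (q z) * ennpowr (T i j) q0 \<partial>count_space UNIV)"
          by (rule nn_integral_ge_point) simp
        then show ?thesis by (simp add: S_def mult_left_mono)
      qed
      finally have "ennpowr (ennreal (1 / C) * (\<phi> i j z * T i j)) (q z) \<le> ennpowr (ennpowr (S z) (1 / q z)) (q z)"
        using qpos[of z] by (simp add: ennpowr_ennpowr)
      then have "ennreal (1 / C) * (\<phi> i j z * T i j) \<le> ennpowr (S z) (1 / q z)"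
        using qpos[of z] ennpowr_le_cancel by blast
      then show ?thesis
        using mult_left_mono[OF le, of c] eq by simp
    qed
    have "strong_frac_maximal \<alpha> \<beta> f z * ennreal \<bar>v z\<bar> / ennreal l = c * strong_frac_maximal \<alpha> \<beta> f z"
      using l by (simp add: c_def divide_ennreal[symmetric] ennreal_times_divide mult.commute)
    also have "\<dots> \<le> ennpowr (S z) (1 / q z)"
      unfolding strong_frac_maximal_def z prod.case
      by (subst SUP_mult_left_ennreal, rule SUP_least) (use each z in auto)
    finally have "ennpowr (strong_frac_maximal \<alpha> \<beta> f z * ennreal \<bar>v z\<bar> / ennreal l) (q z) \<le> ennpowr (ennpowr (S z) (1 / q z)) (q z)"
      using qpos by (intro ennpowr_mono)
    then show ?thesis using qpos[of z] by (simp add: ennpowr_ennpowr)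
  qed
  have "(\<integral>\<^sup>+ z\<in>UNIV. ennpowr (strong_frac_maximal \<alpha> \<beta> f z * ennreal \<bar>v z\<bar> / ennreal l) (q z) \<partial>lebesgue) \<le> (\<integral>\<^sup>+ z. S z \<partial>lebesgue)"
    using point by (intro nn_integral_mono) auto
  also have "\<dots> = ennreal (1 / C) * (\<integral>\<^sup>+ij. (\<integral>\<^sup>+ z. ennpowr (\<phi> (fst ij) (snd ij) z) (q z) * ennpowr (T (fst ij) (snd ij)) q0 \<partial>lebesgue) \<partial>count_space UNIV)"
  proof -
    define t where "t ij z = ennpowr (\<phi> (fst ij) (snd ij) z) (q z) * ennpowr (T (fst ij) (snd ij)) q0" for ij z
    have [measurable]: "t ij \<in> borel_measurable lebesgue" for ij
      unfolding t_def by measurable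
    have "(\<integral>\<^sup>+ z. S z \<partial>lebesgue) = (\<integral>\<^sup>+ z. (\<integral>\<^sup>+ij. ennreal (1 / C) * t ij z \<partial>count_space UNIV) \<partial>lebesgue)"
      by (simp add: S_def t_def case_prod_beta' nn_integral_cmult)
    also have "\<dots> = (\<integral>\<^sup>+ij. (\<integral>\<^sup>+ z. ennreal (1 / C) * t ij z \<partial>lebesgue) \<partial>count_space UNIV)"
      by (rule nn_integral_count_space_nn_integral) auto
    also have "\<dots> = ennreal (1 / C) * (\<integral>\<^sup>+ij. (\<integral>\<^sup>+ z. t ij z \<partial>lebesgue) \<partial>count_space UNIV)"
      by (simp add: nn_integral_cmult)
    finally show ?thesis by (simp only: t_def)
  qed
  also have "\<dots> \<le> ennreal (1 / C) * (\<integral>\<^sup>+ij. 1 * ennpowr (T (fst ij) (snd ij)) q0 \<partial>count_space UNIV)"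
    by (intro mult_left_mono nn_integral_mono, subst nn_integral_multc) (auto intro: mult_right_mono[OF \<phi>1, simplified])
  also have "\<dots> \<le> ennreal (1 / C) * ennreal C"
    using T_sum by (intro mult_left_mono) (simp_all add: case_prod_beta')
  also have "\<dots> = 1" using C1 by (simp flip: ennreal_mult)
  finally show ?thesis
    unfolding Lvar_weighted_norm_def Lvar_norm_def l_def[symmetric] using l
    by (intro Inf_lower) blast
qed

lemma Lvar_norm_mono:
  assumes q: "\<And>z. 0 < q z" and le: "\<And>z. z \<in> E \<Longrightarrow> F z \<le> G z" and E: "E \<subseteq> E'"
  shows "Lvar_norm q E F \<le> Lvar_norm q E' G"
proof -
  have "(\<integral>\<^sup>+ z\<in>E. ennpowr (F z / ennreal l) (q z) \<partial>lebesgue) \<le> (\<integral>\<^sup>+ z\<in>E'. ennpowr (G z / ennreal l) (q z) \<partial>lebesgue)" for l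
    using E by (intro nn_integral_mono) (auto simp: indicator_def intro!: ennpowr_mono divide_right_mono_ennreal q le)
  then show ?thesis
    unfolding Lvar_norm_def by (intro Inf_superset_mono) (blast intro: order_trans)
qed

text \<open>A norm below \<open>X\<close> provides an admissible \<open>l < X\<close>, and admissibility passes to larger numbers. The
strict inequality avoids the question whether the infimum is attained.\<close>

lemma Lvar_norm_less_imp_integral_le:
  assumes q: "\<And>z. 0 < q z" and less: "Lvar_norm q E F < ennreal X"
  shows "(\<integral>\<^sup>+ z\<in>E. ennpowr (F z / ennreal X) (q z) \<partial>lebesgue) \<le> 1"
proof -
  obtain l where l: "0 < l" "ennreal l < ennreal X" "(\<integral>\<^sup>+ z\<in>E. ennpowr (F z / ennreal l) (q z) \<partial>lebesgue) \<le> 1"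
    using less unfolding Lvar_norm_def Inf_less_iff by blast
  have "(\<integral>\<^sup>+ z\<in>E. ennpowr (F z / ennreal X) (q z) \<partial>lebesgue) \<le> (\<integral>\<^sup>+ z\<in>E. ennpowr (F z / ennreal l) (q z) \<partial>lebesgue)"
  proof -
    have "l < X" using l by (simp add: ennreal_less_iff)
    then have "inverse (ennreal X) \<le> inverse (ennreal l)"
      using l(1) by (simp add: inverse_ennreal ennreal_leI)
    then show ?thesis
      unfolding divide_ennreal_def by (intro nn_integral_mono mult_right_mono ennpowr_mono q mult_left_mono) auto
  qed
  with l(3) show ?thesis by simp
qed

definition testing_constant ::
  "real \<Rightarrow> (real \<times> real \<Rightarrow> real) \<Rightarrow> (real \<times> real \<Rightarrow> real) \<Rightarrow> (real \<Rightarrow> real) \<Rightarrow> (real \<Rightarrow> real) \<Rightarrow> ennreal" where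
  "testing_constant p q v \<alpha> \<beta> = (SUP (I, J) \<in> bounded_intervals \<times> bounded_intervals.
       Lvar_norm q (I \<times> J)
         (\<lambda>(s, t). ennreal \<bar>measure lebesgue I powr \<alpha> s * measure lebesgue J powr \<beta> t * v (s, t)\<bar>) *
       ennreal (measure lebesgue (I \<times> J) powr (- 1 / p)))"

text \<open>The testing condition for the rectangles with dyadic sides is fed into the modular estimate. The
strict inequality between the testing constant and \<open>A\<close> makes \<open>A |R|^(1/p)\<close> admissible in the
definition of the norm.\<close>

lemma bounded_if_testing_constant_finite:
  fixes q v :: "real \<times> real \<Rightarrow> real"
  assumes p: "1 < p" "p < q0" and q0: "\<And>z. q0 \<le> q z"
    and meas: "q \<in> borel_measurable lebesgue" "v \<in> borel_measurable lebesgue"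
      "\<alpha> \<in> borel_measurable lebesgue" "\<beta> \<in> borel_measurable lebesgue"
    and \<alpha>: "\<And>x. 0 \<le> \<alpha> x" "\<And>x. \<alpha> x \<le> 1" and \<beta>: "\<And>x. 0 \<le> \<beta> x" "\<And>x. \<beta> x \<le> 1"
    and fin: "testing_constant p q v \<alpha> \<beta> < \<infinity>"
  shows "bounded_Lp_Lvar_weighted p q v (strong_frac_maximal \<alpha> \<beta>)"
proof -
  have qpos: "0 < q z" for z using p q0[of z] by simp
  obtain A where A: "0 < A" "testing_constant p q v \<alpha> \<beta> < ennreal A"
  proof -
    obtain B where "testing_constant p q v \<alpha> \<beta> = ennreal B" "0 \<le> B"
      using fin by (cases "testing_constant p q v \<alpha> \<beta>") auto
    then show thesis by (intro that[of "B + 1"]) (auto simp: ennreal_less_iff)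
  qed
  have cond: "(\<integral>\<^sup>+z\<in>dyad i \<times> dyad j.
      ennpowr (ennreal (dlen i powr \<alpha> (fst z) * dlen j powr \<beta> (snd z) * \<bar>v z\<bar> / (A * (dlen i * dlen j) powr (1/p)))) (q z) \<partial>lebesgue) \<le> 1" for i j
  proof -
    define m where "m = dlen i * dlen j"
    have m: "0 < m" by (simp add: m_def)
    define F where "F = (\<lambda>(s, t). ennreal \<bar>dlen i powr \<alpha> s * dlen j powr \<beta> t * v (s, t)\<bar>)"
    have "Lvar_norm q (dyad i \<times> dyad j) F * ennreal (m powr (- 1 / p)) \<le> testing_constant p q v \<alpha> \<beta>"
      unfolding testing_constant_def
      by (rule SUP_upper2[where i = "(dyad i, dyad j)"])
        (auto simp: dyad_bounded_interval measure_rectangle measure_dyad m_def F_def)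
    then have less: "Lvar_norm q (dyad i \<times> dyad j) F * ennreal (m powr (- 1 / p)) < ennreal A"
      using A(2) by simp
    have X: "0 < A * m powr (1/p)" using A m by simp
    have "Lvar_norm q (dyad i \<times> dyad j) F < ennreal (A * m powr (1/p))"
    proof (rule ccontr)
      assume "\<not> ?thesis"
      then have "ennreal (A * m powr (1/p)) * ennreal (m powr (- 1 / p)) \<le> Lvar_norm q (dyad i \<times> dyad j) F * ennreal (m powr (- 1 / p))"
        by (intro mult_right_mono) auto
      moreover have "A * m powr (1/p) * m powr (- 1 / p) = A"
        using m by (simp add: mult.assoc flip: powr_add)
      then have "ennreal (A * m powr (1/p)) * ennreal (m powr (- 1 / p)) = ennreal A"
        using A by (simp flip: ennreal_mult)
      ultimately show False using less by simp
    qed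
    from Lvar_norm_less_imp_integral_le[OF qpos this]
    have "(\<integral>\<^sup>+ z\<in>dyad i \<times> dyad j. ennpowr (F z / ennreal (A * m powr (1/p))) (q z) \<partial>lebesgue) \<le> 1" .
    moreover have "F z / ennreal (A * m powr (1/p))
        = ennreal (dlen i powr \<alpha> (fst z) * dlen j powr \<beta> (snd z) * \<bar>v z\<bar> / (A * (dlen i * dlen j) powr (1/p)))" for z
      using X by (cases z) (simp add: F_def divide_ennreal abs_mult m_def)
    ultimately show ?thesis by simp
  qed
  obtain C0 where C0: "0 < C0" "\<And>f. f \<in> borel_measurable borel \<Longrightarrow> (\<integral>\<^sup>+z. ennpowr (f z) p \<partial>lborel) \<le> 1 \<Longrightarrow>
      (\<integral>\<^sup>+(i, j). ennpowr (ennreal ((dlen i * dlen j) powr (1/p - 1)) *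
       (\<integral>\<^sup>+z\<in>dyad i \<times> dyad j. f z \<partial>lborel)) q0 \<partial>count_space UNIV) \<le> ennreal C0"
    using carleson_embedding_product[OF p] by blast
  define C where "C = max 1 C0"
  have C: "(\<integral>\<^sup>+(i, j). ennpowr (ennreal ((dlen i * dlen j) powr (1/p - 1)) *
       (\<integral>\<^sup>+z\<in>dyad i \<times> dyad j. f z \<partial>lborel)) q0 \<partial>count_space UNIV) \<le> ennreal C"
    if "f \<in> borel_measurable borel" "(\<integral>\<^sup>+z. ennpowr (f z) p \<partial>lborel) \<le> 1" for f
    by (rule order_trans[OF C0(2)[OF that]]) (simp add: C_def ennreal_leI)
  have "1 \<le> C" by (simp add: C_def)
  define c where "c = 16 * A * C"
  have c: "0 < c" using A \<open>1 \<le> C\<close> by (simp add: c_def)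
  have "Lvar_weighted_norm q v (strong_frac_maximal \<alpha> \<beta> f) \<le> ennreal c * Lp_norm p f"
    if f: "f \<in> Lp_space p" for f
  \<comment> \<open>The modular estimate needs a positive number \<open>N\<close> above the norm of \<open>f\<close>; the slack \<open>e / c\<close>
    also covers the case of norm zero.\<close>
  proof (rule ennreal_le_epsilon)
    fix e :: real assume e: "0 < e"
    obtain n where n: "Lp_norm p f = ennreal n" "0 \<le> n"
      using f by (cases "Lp_norm p f") (auto simp: Lp_space_def)
    define N where "N = n + e / c"
    have N: "0 < N" "n \<le> N" using n e c by (auto simp: N_def add_nonneg_pos)
    have "ennpowr (\<integral>\<^sup>+z. ennreal (\<bar>f z\<bar> powr p) \<partial>lebesgue) (1/p) \<le> ennpowr (ennreal (N powr p)) (1/p)"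
      using n N p by (simp add: Lp_norm_def[symmetric] ennpowr_ennreal powr_powr ennreal_leI)
    then have "(\<integral>\<^sup>+z. ennreal (\<bar>f z\<bar> powr p) \<partial>lebesgue) \<le> ennreal (N powr p)"
      by (rule ennpowr_le_cancel[rotated]) (use p in simp)
    then have "Lvar_weighted_norm q v (strong_frac_maximal \<alpha> \<beta> f) \<le> ennreal (16 * A * C * N)"
      using f by (intro maximal_weighted_norm_le[OF p q0 meas \<alpha> \<beta> A(1) cond C \<open>1 \<le> C\<close> _ N(1)]) (auto simp: Lp_space_def)
    also have "16 * A * C * N = c * n + e"
      unfolding c_def[symmetric] using c by (simp add: N_def field_simps)
    finally show "Lvar_weighted_norm q v (strong_frac_maximal \<alpha> \<beta> f) \<le> ennreal c * Lp_norm p f + ennreal e"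
      using c n e by (simp add: ennreal_mult)
  qed
  with c show ?thesis by (auto simp: bounded_Lp_Lvar_weighted_def)
qed

section \<open>Boundedness implies the testing condition\<close>

lemma testing_constant_finite_if_bounded:
  assumes p: "1 < p" and q: "\<And>z. 0 < q z"
    and bdd: "bounded_Lp_Lvar_weighted p q v (strong_frac_maximal \<alpha> \<beta>)"
  shows "testing_constant p q v \<alpha> \<beta> < \<infinity>"
proof -
  obtain c where c: "0 < c" "\<And>f. f \<in> Lp_space p \<Longrightarrow> Lvar_weighted_norm q v (strong_frac_maximal \<alpha> \<beta> f) \<le> ennreal c * Lp_norm p f"
    using bdd by (auto simp: bounded_Lp_Lvar_weighted_def)
  have "Lvar_norm q (I \<times> J)
         (\<lambda>(s, t). ennreal \<bar>measure lebesgue I powr \<alpha> s * measure lebesgue J powr \<beta> t * v (s, t)\<bar>) *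
       ennreal (measure lebesgue (I \<times> J) powr (- 1 / p)) \<le> ennreal c"
    if IJ: "I \<in> bounded_intervals" "J \<in> bounded_intervals" for I J
  proof -
    define m where "m = measure lebesgue (I \<times> J)"
    have pos: "0 < measure lebesgue I" "0 < measure lebesgue J"
      using IJ by (auto simp: bounded_intervals_def)
    have m: "0 < m" "m = measure lebesgue I * measure lebesgue J"
      using pos measure_rectangle[OF IJ] by (auto simp: m_def)
    have R: "I \<times> J \<in> sets lebesgue" "emeasure lebesgue (I \<times> J) = ennreal m"
      using borel_rectangle[OF IJ] emeasure_rectangle[OF IJ] m by auto
    define f :: "real \<times> real \<Rightarrow> real" where "f = indicator (I \<times> J)"
    have "(\<integral>\<^sup>+ z. ennreal (\<bar>f z\<bar> powr p) \<partial>lebesgue) = (\<integral>\<^sup>+ z. indicator (I \<times> J) z \<partial>lebesgue)"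
      by (intro nn_integral_cong) (auto simp: f_def indicator_def)
    also have "\<dots> = ennreal m" using R by (simp add: nn_integral_indicator)
    finally have norm: "Lp_norm p f = ennreal (m powr (1 / p))"
      using m by (simp add: Lp_norm_def ennpowr_ennreal)
    then have f: "f \<in> Lp_space p"
      using R by (auto simp: Lp_space_def f_def intro!: borel_measurable_indicator)
    have int: "(\<integral>\<^sup>+ z\<in>I \<times> J. ennreal \<bar>f z\<bar> \<partial>lebesgue) = ennreal m"
    proof -
      have "(\<integral>\<^sup>+ z\<in>I \<times> J. ennreal \<bar>f z\<bar> \<partial>lebesgue) = (\<integral>\<^sup>+ z. indicator (I \<times> J) z \<partial>lebesgue)"
        by (intro nn_integral_cong) (auto simp: f_def indicator_def)
      then show ?thesis using R by (simp add: nn_integral_indicator)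
    qed
    have lower: "ennreal (measure lebesgue I powr \<alpha> s * measure lebesgue J powr \<beta> t) \<le> strong_frac_maximal \<alpha> \<beta> f (s, t)"
      if "s \<in> I" "t \<in> J" for s t
    proof -
      have "measure lebesgue I powr \<alpha> s * measure lebesgue J powr \<beta> t
          = measure lebesgue I powr (\<alpha> s - 1) * measure lebesgue J powr (\<beta> t - 1) * m"
        using pos by (simp add: m powr_diff)
      then have "ennreal (measure lebesgue I powr \<alpha> s * measure lebesgue J powr \<beta> t)
          = ennreal (measure lebesgue I powr (\<alpha> s - 1) * measure lebesgue J powr (\<beta> t - 1)) * (\<integral>\<^sup>+ z\<in>I \<times> J. ennreal \<bar>f z\<bar> \<partial>lebesgue)"
        using m(1) by (simp only: int) (simp add: ennreal_mult)
      also have "\<dots> \<le> strong_frac_maximal \<alpha> \<beta> f (s, t)"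
        unfolding strong_frac_maximal_def prod.case
        by (rule SUP_upper2[where i = "(I, J)"]) (use IJ that in auto)
      finally show ?thesis .
    qed
    have "Lvar_norm q (I \<times> J) (\<lambda>(s, t). ennreal \<bar>measure lebesgue I powr \<alpha> s * measure lebesgue J powr \<beta> t * v (s, t)\<bar>)
        \<le> Lvar_weighted_norm q v (strong_frac_maximal \<alpha> \<beta> f)"
      unfolding Lvar_weighted_norm_def
    proof (rule Lvar_norm_mono[OF q])
      show "(case z of (s, t) \<Rightarrow> ennreal \<bar>measure lebesgue I powr \<alpha> s * measure lebesgue J powr \<beta> t * v (s, t)\<bar>)
          \<le> strong_frac_maximal \<alpha> \<beta> f z * ennreal \<bar>v z\<bar>" if "z \<in> I \<times> J" for z
        using that lower[of "fst z" "snd z"]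
        by (cases z) (auto simp: abs_mult ennreal_mult intro!: mult_right_mono)
    qed simp
    also have "\<dots> \<le> ennreal c * ennreal (m powr (1 / p))"
      using c(2)[OF f] norm by simp
    finally have "Lvar_norm q (I \<times> J) (\<lambda>(s, t). ennreal \<bar>measure lebesgue I powr \<alpha> s * measure lebesgue J powr \<beta> t * v (s, t)\<bar>)
        * ennreal (m powr (- 1 / p)) \<le> ennreal c * ennreal (m powr (1 / p)) * ennreal (m powr (- 1 / p))"
      by (rule mult_right_mono) simp
    also have "\<dots> = ennreal (c * (m powr (1 / p) * m powr (- 1 / p)))"
      using c(1) by (simp add: ennreal_mult mult.assoc)
    also have "m powr (1 / p) * m powr (- 1 / p) = 1"
      using m(1) by (simp flip: powr_add)
    finally show ?thesis by (simp add: m_def)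
  qed
  then have "testing_constant p q v \<alpha> \<beta> \<le> ennreal c"
    unfolding testing_constant_def by (intro SUP_least) auto
  then show ?thesis by (simp add: le_less_trans)
qed

section \<open>The characterization\<close>

lemma fun_inf_le: "fun_inf g \<le> ereal (g x)"
  unfolding fun_inf_def by (rule INF_lower) simp

lemma fun_sup_ge: "ereal (g x) \<le> fun_sup g"
  unfolding fun_sup_def by (rule SUP_upper) simp

theorem theorem4p2:
  fixes p :: real
    and q v :: "real \<times> real \<Rightarrow> real"
    and \<alpha> \<beta> :: "real \<Rightarrow> real"
  assumes "q \<in> borel_measurable lebesgue"
    and "1 < p" and "ereal p < fun_inf q" and "fun_inf q \<le> fun_sup q" and "fun_sup q < \<infinity>"
    and "\<alpha> \<in> borel_measurable lebesgue"
    and "ereal (1 / p) - 1 / fun_sup q < fun_inf \<alpha>" and "fun_inf \<alpha> \<le> fun_sup \<alpha>"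
    and "fun_sup \<alpha> < ereal (1 / p)"
    and "\<beta> \<in> borel_measurable lebesgue"
    and "ereal (1 / p) - 1 / fun_sup q < fun_inf \<beta>" and "fun_inf \<beta> \<le> fun_sup \<beta>"
    and "fun_sup \<beta> < ereal (1 / p)"
    and "weight v"
  shows "bounded_Lp_Lvar_weighted p q v (strong_frac_maximal \<alpha> \<beta>) \<longleftrightarrow>
    (SUP (I, J) \<in> bounded_intervals \<times> bounded_intervals.
       Lvar_norm q (I \<times> J)
         (\<lambda>(s, t). ennreal \<bar>measure lebesgue I powr \<alpha> s * measure lebesgue J powr \<beta> t * v (s, t)\<bar>) *
       ennreal (measure lebesgue (I \<times> J) powr (- 1 / p))) < \<infinity>"
proof -
  obtain q0 where q0: "p < q0" "ereal q0 < fun_inf q"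
    using ereal_dense2[OF assms(3)] by auto
  have q_ge: "q0 \<le> q z" for z
    using less_le_trans[OF q0(2) fun_inf_le[of q z]] by simp
  obtain Q where Q: "fun_sup q = ereal Q" "p < Q"
  proof -
    have "ereal p < fun_sup q" using assms(3,4) by order
    then show thesis using assms(5) that by (cases "fun_sup q") auto
  qed
  \<comment> \<open>Since \<open>q\<^sub>+ > p\<close>, the lower bound for the orders is nonnegative.\<close>
  have lower: "0 \<le> ereal (1 / p) - 1 / fun_sup q"
    using Q assms(2) by (simp add: one_ereal_def frac_le)
  have range: "0 \<le> g x \<and> g x \<le> 1"
    if "ereal (1 / p) - 1 / fun_sup q < fun_inf g" "fun_sup g < ereal (1 / p)" for g :: "real \<Rightarrow> real" and x
  proof -
    have "0 \<le> ereal (g x)"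
      using lower that(1) fun_inf_le[of g x] by order
    moreover have "ereal (g x) \<le> ereal (1 / p)"
      using that(2) fun_sup_ge[of g x] by order
    moreover have "1 / p \<le> 1" using assms(2) by simp
    ultimately show ?thesis by simp
  qed
  have \<alpha>: "0 \<le> \<alpha> x" "\<alpha> x \<le> 1" and \<beta>: "0 \<le> \<beta> x" "\<beta> x \<le> 1" for x
    using range assms(7,9,11,13) by blast+
  have "bounded_Lp_Lvar_weighted p q v (strong_frac_maximal \<alpha> \<beta>) \<longleftrightarrow> testing_constant p q v \<alpha> \<beta> < \<infinity>"
  proof
    have "0 < q z" for z using q_ge[of z] q0 assms(2) by simp
    then show "testing_constant p q v \<alpha> \<beta> < \<infinity>" if "bounded_Lp_Lvar_weighted p q v (strong_frac_maximal \<alpha> \<beta>)"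
      using testing_constant_finite_if_bounded[OF assms(2) _ that] by blast
  next
    show "bounded_Lp_Lvar_weighted p q v (strong_frac_maximal \<alpha> \<beta>)" if "testing_constant p q v \<alpha> \<beta> < \<infinity>"
      using assms(14)
      by (intro bounded_if_testing_constant_finite[OF assms(2) q0(1) q_ge assms(1) _ assms(6,10) \<alpha> \<beta> that])
        (simp add: weight_def)
  qed
  then show ?thesis unfolding testing_constant_def .
qed

end
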